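(* Let $f(z)$ be a meromorphic function in $\mathbb{C}$ of finite order $\sigma$, $f\not\equiv0$. Then, as $r\to\infty$, $$\lim_{\eta\to0}m_\eta\Big(r,\frac1\eta\Big(\frac{f(z+\eta)}{f(z)}-1\Big)\Big)=O(\log r)\quad\text{when }\sigma\ge1,$$ $$\lim_{\eta\to0}m_\eta\Big(r,\frac1\eta\Big(\frac{f(z+\eta)}{f(z)}-1\Big)\Big)=O(1)\quad\text{when }\sigma<1 .$$
   Context: $m(r,g)=\frac1{2\pi}\int_0^{2\pi}\log^+|g(re^{i\theta})|\,d\theta$ is the Nevanlinna proximity function; $m_\eta$ is the same function, the subscript only emphasizing the dependence on $\eta\in\mathbb{C}\setminus\{0\}$. The order of $f$ is $\sigma=\limsup_{r\to\infty}\log^+T(r,f)/\log r$. *)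

theory Defs
  imports "HOL-Complex_Analysis.Complex_Analysis" "HOL-Library.Landau_Symbols"
begin

(* The maximum is taken inside the logarithm, so that log_plus 0 = 0. *)
definition log_plus :: "real \<Rightarrow> real" where
  "log_plus x = ln (max 1 x)"

definition proximity :: "real \<Rightarrow> (complex \<Rightarrow> complex) \<Rightarrow> real" where
  "proximity r g =
     1 / (2 * pi) * integral {0..2 * pi} (\<lambda>\<theta>. log_plus (norm (g (of_real r * cis \<theta>))))"

(* Poles are counted with multiplicity; zorder is negative at a pole. *)
definition pole_count :: "real \<Rightarrow> (complex \<Rightarrow> complex) \<Rightarrow> real" where
  "pole_count t f = (\<Sum>z | norm z \<le> t \<and> is_pole f z. real_of_int (- zorder f z))"

definition pole_counting :: "real \<Rightarrow> (complex \<Rightarrow> complex) \<Rightarrow> real" where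
  "pole_counting r f =
     integral {0..r} (\<lambda>t. (pole_count t f - pole_count 0 f) / t) + pole_count 0 f * ln r"

definition nevanlinna_char :: "real \<Rightarrow> (complex \<Rightarrow> complex) \<Rightarrow> real" where
  "nevanlinna_char r f = proximity r f + pole_counting r f"

definition nevanlinna_order :: "(complex \<Rightarrow> complex) \<Rightarrow> ereal" where
  "nevanlinna_order f =
     Limsup at_top (\<lambda>r::real. ereal (log_plus (nevanlinna_char r f) / ln r))"

end

(*
  The limit is the proximity function of the logarithmic derivative f'/f. On a disc, f is
  exp u times a finite product of powers (z - a)^k, so the logarithm of the difference quotient is
  dominated by a constant plus finitely many terms -ln|z - a| and -ln|z + eta - a|. By Jensen's
  formula their circle means are continuous in eta, and dominated convergence with a varying
  majorant applies.

  For the growth, f'/f = u' + sum k/(z - a) on |z| = r, where the factorization is taken on the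
  disc of radius 3 r. The formula expressing u' through Re u on |z| = 2 r bounds u' by the
  characteristic, and the number n of zeros and poles is also bounded by the characteristic through
  Jensen's formula; both give r^(sigma + epsilon - 1) up to logarithms and r^(sigma + epsilon). For
  0 < alpha < 1 the mean of |z - a|^(-alpha) over the circle is at most C r^(-alpha), uniformly in a.
  Concavity of the logarithm then gives
  m(r, f'/f) <= (1/alpha) ln (1 + |u'|^alpha + C n r^(-alpha)), which is O(log r) always and O(1)
  when sigma + epsilon < alpha < 1.
*)

theory Submission
  imports Defs
begin

section \<open>Means over circles\<close>

text \<open>The claim allows no exceptional radii, so circles that pass near or through zeros and
  poles have to be treated. On a circle through \<open>a\<close> the function
  \<open>1/|z - a|\<close> is not integrable, while powers of it with exponent below 1 are; this
  forces the exponent \<open>al < 1\<close>, and it forces every estimate to be uniform in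
  \<open>a\<close>. For the limit the difficulty is that a pole \<open>a\<close> on the circle moves
  to \<open>a - eta\<close>: the supremum over small \<open>eta\<close> of
  \<open>-ln |z + eta - a|\<close> is infinite on a whole arc, so no fixed integrable majorant
  exists. A majorant that moves with \<open>eta\<close>, but whose mean is known exactly, takes its
  place.

  A formal obstacle shapes the statements: \<open>f\<close> is a total function with arbitrary
  values on a sparse set, and \<open>ln 0\<close> and \<open>0 powr x\<close> are 0. Pointwise
  comparisons thus hold only off a finite set of points on each circle, and this exceptional set is
  carried along in the lemmas on means.\<close>

definition circ_mean :: "real \<Rightarrow> (complex \<Rightarrow> real) \<Rightarrow> real" where
  "circ_mean r g = (1 / (2 * pi)) * (LINT t|lebesgue_on {0..2*pi}. g (of_real r * cis t))"

definition circ_integrable :: "real \<Rightarrow> (complex \<Rightarrow> real) \<Rightarrow> bool" where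
  "circ_integrable r g \<longleftrightarrow> integrable (lebesgue_on {0..2*pi}) (\<lambda>t. g (of_real r * cis t))"

lemma emeasure_circ: "emeasure (lebesgue_on {0..2*pi}) (space (lebesgue_on {0..2*pi})) = ennreal (2*pi)"
  by (subst emeasure_restrict_space) auto

lemma measure_circ: "measure (lebesgue_on {0..2*pi}) (space (lebesgue_on {0..2*pi})) = 2*pi"
  unfolding Sigma_Algebra.measure_def emeasure_circ by simp

lemma circ_integrable_const [simp]: "circ_integrable r (\<lambda>_. c)"
  unfolding circ_integrable_def
  by (intro finite_measure.integrable_const finite_measureI) (unfold emeasure_circ, simp)

lemma circ_mean_const [simp]: "circ_mean r (\<lambda>_. c) = c"
  unfolding circ_mean_def lebesgue_integral_const measure_circ by simp

lemma circ_integrable_add: "circ_integrable r f \<Longrightarrow> circ_integrable r g \<Longrightarrow> circ_integrable r (\<lambda>z. f z + g z)"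
  unfolding circ_integrable_def by (rule Bochner_Integration.integrable_add)

lemma circ_integrable_diff: "circ_integrable r f \<Longrightarrow> circ_integrable r g \<Longrightarrow> circ_integrable r (\<lambda>z. f z - g z)"
  unfolding circ_integrable_def by (rule Bochner_Integration.integrable_diff)

lemma circ_integrable_cmult: "circ_integrable r f \<Longrightarrow> circ_integrable r (\<lambda>z. c * f z)"
  unfolding circ_integrable_def by simp

lemma circ_integrable_sum: "(\<And>a. a \<in> A \<Longrightarrow> circ_integrable r (f a)) \<Longrightarrow> circ_integrable r (\<lambda>z. \<Sum>a\<in>A. f a z)"
  unfolding circ_integrable_def by simp

lemma circ_integrable_abs: "circ_integrable r f \<Longrightarrow> circ_integrable r (\<lambda>z. \<bar>f z\<bar>)"
  unfolding circ_integrable_def by simp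

lemma circ_integrable_max: "circ_integrable r f \<Longrightarrow> circ_integrable r g \<Longrightarrow> circ_integrable r (\<lambda>z. max (f z) (g z))"
  unfolding circ_integrable_def by (rule integrable_max)

lemma circ_mean_add: "circ_integrable r f \<Longrightarrow> circ_integrable r g \<Longrightarrow> circ_mean r (\<lambda>z. f z + g z) = circ_mean r f + circ_mean r g"
  unfolding circ_integrable_def circ_mean_def by (simp add: algebra_simps add_divide_distrib)

lemma circ_mean_diff: "circ_integrable r f \<Longrightarrow> circ_integrable r g \<Longrightarrow> circ_mean r (\<lambda>z. f z - g z) = circ_mean r f - circ_mean r g"
  unfolding circ_integrable_def circ_mean_def by (simp add: algebra_simps diff_divide_distrib)

lemma circ_mean_cmult: "circ_mean r (\<lambda>z. c * f z) = c * circ_mean r f"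
  unfolding circ_mean_def by simp

lemma circ_mean_sum: "(\<And>a. a \<in> A \<Longrightarrow> circ_integrable r (f a)) \<Longrightarrow> circ_mean r (\<lambda>z. \<Sum>a\<in>A. f a z) = (\<Sum>a\<in>A. circ_mean r (f a))"
  unfolding circ_integrable_def circ_mean_def by (simp add: sum_distrib_left sum_divide_distrib)

text \<open>The parametrization is injective only on \<open>{0..<2*pi}\<close>; the endpoint
  \<open>2*pi\<close> repeats the point of parameter 0 and is added by hand.\<close>

lemma finite_cis_eq:
  assumes "r \<noteq> 0" "finite E"
  shows "finite {t\<in>{0..2*pi}. of_real r * cis t \<in> E}"
proof -
  have "{t\<in>{0..2*pi}. of_real r * cis t \<in> E} \<subseteq> {2*pi} \<union> ((\<lambda>t. of_real r * cis t) -` E \<inter> {0..<2*pi})"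
    by auto
  moreover have "finite ((\<lambda>t. of_real r * cis t) -` E \<inter> {0..<2*pi})"
  proof (intro finite_vimage_IntI assms inj_onI)
    fix x y assume xy: "x \<in> {0..<2*pi}" "y \<in> {0..<2*pi}" "of_real r * cis x = of_real r * cis y"
    then have "cis x = cis y" using assms by simp
    moreover have "Arg2pi (cis x) = x" "Arg2pi (cis y) = y"
      using xy Arg2pi_unique[of 1 x "cis x"] Arg2pi_unique[of 1 y "cis y"] by (auto simp: cis_conv_exp)
    ultimately show "x = y" by metis
  qed
  ultimately show ?thesis
    using finite_subset by blast
qed

lemma AE_circ_not_in_finite:
  assumes "r \<noteq> 0" "finite E"
  shows "AE t in lebesgue_on {0..2*pi}. of_real r * cis t \<notin> E"
proof (rule AE_I')
  let ?N = "{t\<in>{0..2*pi}. of_real r * cis t \<in> E}"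
  have "?N \<in> null_sets lborel"
    using finite_cis_eq[OF assms] by (rule finite_imp_null_set_lborel)
  then have "?N \<in> null_sets lebesgue"
    by (rule null_sets_completionI)
  then show "?N \<in> null_sets (lebesgue_on {0..2*pi})"
    by (subst null_sets_restrict_space) auto
qed auto

text \<open>The finite set \<open>E\<close> absorbs the zeros, poles and conventional values at
  which the comparison may fail; its preimage under the parametrization is a null set.\<close>

lemma circ_mean_mono:
  assumes "r \<noteq> 0" "circ_integrable r f" "circ_integrable r g" "finite E"
    and "\<And>z. norm z = \<bar>r\<bar> \<Longrightarrow> z \<notin> E \<Longrightarrow> f z \<le> g z"
  shows "circ_mean r f \<le> circ_mean r g"
proof -
  have "AE t in lebesgue_on {0..2*pi}. f (of_real r * cis t) \<le> g (of_real r * cis t)"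
    using AE_circ_not_in_finite[OF assms(1,4)] by eventually_elim (auto intro: assms(5) simp: norm_mult)
  then show ?thesis
    using assms(2,3) unfolding circ_mean_def circ_integrable_def
    by (intro mult_left_mono integral_mono_AE) auto
qed

lemma measurable_circ:
  fixes g :: "complex \<Rightarrow> 'b::{second_countable_topology,t2_space}"
  assumes "g \<in> borel_measurable borel"
  shows "(\<lambda>t. g (of_real r * cis t)) \<in> borel_measurable (lebesgue_on {0..2*pi})"
proof -
  have "continuous_on UNIV (\<lambda>t. of_real r * cis t)"
    by (intro continuous_intros)
  then have "(\<lambda>t. of_real r * cis t) \<in> borel_measurable borel"
    by (rule borel_measurable_continuous_onI)
  then have "(\<lambda>t. g (of_real r * cis t)) \<in> borel_measurable borel"
    using assms by (rule measurable_compose)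
  then have "(\<lambda>t. g (of_real r * cis t)) \<in> borel_measurable lebesgue"
    by (simp add: measurable_completion)
  then show ?thesis
    by (rule measurable_restrict_space1)
qed

lemma circ_cong_AE:
  assumes "r \<noteq> 0" "f \<in> borel_measurable borel" "g \<in> borel_measurable borel" "finite E"
    and "\<And>z. norm z = \<bar>r\<bar> \<Longrightarrow> z \<notin> E \<Longrightarrow> f z = g z"
  shows "circ_mean r f = circ_mean r g" "circ_integrable r f \<longleftrightarrow> circ_integrable r g"
proof -
  have "AE t in lebesgue_on {0..2*pi}. f (of_real r * cis t) = g (of_real r * cis t)"
    using AE_circ_not_in_finite[OF assms(1,4)] by eventually_elim (auto intro: assms(5) simp: norm_mult)
  note * = measurable_circ[OF assms(2), of r] measurable_circ[OF assms(3), of r] this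
  show "circ_mean r f = circ_mean r g" "circ_integrable r f \<longleftrightarrow> circ_integrable r g"
    unfolding circ_mean_def circ_integrable_def integral_cong_AE[OF *] integrable_cong_AE[OF *] by simp_all
qed

lemma circ_integrable_bound:
  assumes "r \<noteq> 0" "g \<in> borel_measurable borel" "circ_integrable r h" "finite E"
    and "\<And>z. norm z = \<bar>r\<bar> \<Longrightarrow> z \<notin> E \<Longrightarrow> \<bar>g z\<bar> \<le> h z"
  shows "circ_integrable r g"
  unfolding circ_integrable_def
proof (rule Bochner_Integration.integrable_bound)
  show "integrable (lebesgue_on {0..2*pi}) (\<lambda>t. h (of_real r * cis t))"
    using assms(3) by (simp add: circ_integrable_def)
  show "AE t in lebesgue_on {0..2*pi}. norm (g (of_real r * cis t)) \<le> norm (h (of_real r * cis t))"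
    using AE_circ_not_in_finite[OF assms(1,4)]
    by eventually_elim (use assms(5) in \<open>auto simp: norm_mult intro: order_trans[OF _ abs_ge_self]\<close>)
qed (intro measurable_circ assms)

text \<open>\<open>proximity\<close> is a gauge integral, whereas monotonicity almost everywhere and
  dominated convergence are applied to the Lebesgue integral; for integrable functions the two
  agree.\<close>

lemma proximity_conv_circ_mean:
  assumes "circ_integrable r (\<lambda>z. log_plus (norm (g z)))"
  shows "proximity r g = circ_mean r (\<lambda>z. log_plus (norm (g z)))"
  using assms unfolding proximity_def circ_mean_def circ_integrable_def
  by (simp add: lebesgue_integral_eq_integral)

section \<open>Uniform circle means of negative powers of the distance to a point\<close>

lemma abs_sin_ge:
  assumes "\<bar>x\<bar> \<le> pi / 2"
  shows "\<bar>sin x\<bar> \<ge> \<bar>x\<bar> / 3"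
proof -
  have *: "sin x \<ge> x / 3" if "0 \<le> x" "x \<le> pi/2" for x :: real
  \<comment> \<open>Up to pi/3 the derivative cos is at least 1/2. Beyond it sin stays above sqrt 3
    / 2, while x/3 is below 2/3.\<close>
  proof (cases "x \<le> pi/3")
    case True
    have "(\<lambda>x. sin x - x/2) 0 \<le> (\<lambda>x. sin x - x/2) x"
    proof (rule DERIV_nonneg_imp_nondecreasing[OF that(1)])
      fix y assume y: "0 \<le> y" "y \<le> x"
      have "cos y \<ge> cos (pi/3)"
        using y True that by (intro cos_monotone_0_pi_le) auto
      then show "\<exists>D. ((\<lambda>x. sin x - x/2) has_real_derivative D) (at y) \<and> 0 \<le> D"
        by (intro exI[of _ "cos y - 1/2"]) (auto intro!: derivative_eq_intros simp: cos_60)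
    qed
    then show ?thesis using that by simp
  next
    case False
    have "sin x \<ge> sin (pi/3)"
      using False that by (intro sin_monotone_2pi_le) auto
    moreover have "sin (pi/3) \<ge> 0.8"
    proof -
      have "sqrt 3 \<ge> (1.6::real)" by (rule real_le_rsqrt) (simp add: power2_eq_square)
      then show ?thesis by (simp add: sin_60)
    qed
    moreover have "x / 3 \<le> 0.8" using that pi_less_4 by simp
    ultimately show ?thesis by simp
  qed
  show ?thesis
    using *[of "\<bar>x\<bar>"] assms by (cases "x \<ge> 0") auto
qed

text \<open>The right-hand side is the distance of the point to the line through 0 and
  \<open>cis b\<close>. It does not involve \<open>s\<close>, which is the source of uniformity in
  the modulus of \<open>a\<close>.\<close>

lemma norm_circ_diff_ge_sin:
  assumes "r > 0"
  shows "norm (of_real r * cis t - of_real s * cis b) \<ge> r * \<bar>sin (t - b)\<bar>"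
proof -
  have "of_real r * cis t - of_real s * cis b = cis b * (of_real r * cis (t - b) - of_real s)"
    by (simp add: algebra_simps cis_mult)
  then have "norm (of_real r * cis t - of_real s * cis b) = norm (of_real r * cis (t - b) - of_real s)"
    by (simp add: norm_mult)
  also have "\<dots> \<ge> \<bar>Im (of_real r * cis (t - b) - of_real s)\<bar>"
    by (rule abs_Im_le_cmod)
  also have "Im (of_real r * cis (t - b) - of_real s) = r * sin (t - b)"
    by simp
  finally show ?thesis using assms by (simp add: abs_mult)
qed

text \<open>Translation invariance makes the bound independent of \<open>c\<close>: the part within
  distance 1 of \<open>c\<close> costs at most 2/(1-al), and elsewhere the integrand is at most
  1.\<close>

lemma nn_integral_powr_bound:
  fixes al :: real
  assumes "0 < al" "al < 1"
  obtains C :: real where "C \<ge> 0"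
    "\<And>c. (\<integral>\<^sup>+t\<in>{0..2*pi}. ennreal (\<bar>t - c\<bar> powr (-al)) \<partial>lborel) \<le> ennreal C"
proof -
  let ?h = "\<lambda>t. ennreal (\<bar>t\<bar> powr (-al)) * indicator {-1..1} t"
  have half: "(\<integral>\<^sup>+t\<in>{0..1}. ennreal (\<bar>t\<bar> powr (-al)) \<partial>lborel) = ennreal (1/(1-al))"
  proof -
    have "((\<lambda>x. x powr (-al)) has_integral (1 powr (-al+1) / (-al+1))) {0..1}"
      using assms by (intro has_integral_powr_from_0) auto
    then have "((\<lambda>x. \<bar>x\<bar> powr (-al)) has_integral (1/(1-al))) {0..1}"
      by (subst has_integral_cong[where g="\<lambda>x. x powr (-al)"]) auto
    then show ?thesis
      by (intro nn_integral_has_integral_lebesgue') (auto simp: assms)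
  qed
  \<comment> \<open>The negative half is the reflection of the positive one; the affine form
    \<open>0 + (-1)*t\<close> is the shape that the substitution rule expects.\<close>
  have "(\<integral>\<^sup>+t. ?h t \<partial>lborel) \<le> (\<integral>\<^sup>+t. ennreal (\<bar>t\<bar> powr (-al)) * indicator {0..1} t 
            + ennreal (\<bar>0 + (-1)*t\<bar> powr (-al)) * indicator {0..1} (0 + (-1)*t) \<partial>lborel)"
    by (intro nn_integral_mono) (auto simp: indicator_def)
  also have "\<dots> = (\<integral>\<^sup>+t. ennreal (\<bar>t\<bar> powr (-al)) * indicator {0..1} t \<partial>lborel)
     + (\<integral>\<^sup>+t. ennreal (\<bar>0 + (-1)*t\<bar> powr (-al)) * indicator {0..1} (0 + (-1)*t) \<partial>lborel)"
    by (rule nn_integral_add) auto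
  also have "(\<integral>\<^sup>+t. ennreal (\<bar>0 + (-1)*t\<bar> powr (-al)) * indicator {0..1} (0 + (-1)*t) \<partial>lborel)
      = (\<integral>\<^sup>+t. ennreal (\<bar>t\<bar> powr (-al)) * indicator {0..1} t \<partial>lborel)"
    using nn_integral_real_affine[of "\<lambda>t. ennreal (\<bar>t\<bar> powr (-al)) * indicator {0..1} t" "-1" 0]
    by simp
  finally have h: "(\<integral>\<^sup>+t. ?h t \<partial>lborel) \<le> ennreal (2/(1-al))"
    using assms by (simp add: half flip: ennreal_plus)
  have "(\<integral>\<^sup>+t\<in>{0..2*pi}. ennreal (\<bar>t - c\<bar> powr (-al)) \<partial>lborel) \<le> ennreal (2*pi + 2/(1-al))" for c
  proof -
    have "(\<integral>\<^sup>+t\<in>{0..2*pi}. ennreal (\<bar>t - c\<bar> powr (-al)) \<partial>lborel) 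
       \<le> (\<integral>\<^sup>+t. indicator {0..2*pi} t + ?h (-c + 1*t) \<partial>lborel)"
    proof (intro nn_integral_mono)
      fix t
      have "\<bar>t - c\<bar> powr (-al) \<le> 1" if "\<bar>t - c\<bar> > 1"
        using powr_mono2'[of "-al" 1 "\<bar>t - c\<bar>"] that assms by simp
      then show "ennreal (\<bar>t - c\<bar> powr - al) * indicator {0..2*pi} t \<le> indicator {0..2*pi} t + ?h (-c + 1*t)"
        by (cases "\<bar>t - c\<bar> > 1") (auto simp: indicator_def)
    qed
    also have "\<dots> = (\<integral>\<^sup>+t. indicator {0..2*pi} t \<partial>lborel) + (\<integral>\<^sup>+t. ?h (-c + 1*t) \<partial>lborel)"
      by (rule nn_integral_add) auto
    also have "(\<integral>\<^sup>+t. ?h (-c + 1*t) \<partial>lborel) = (\<integral>\<^sup>+t. ?h t \<partial>lborel)"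
      using nn_integral_real_affine[of ?h 1 "-c"] by simp
    also have "(\<integral>\<^sup>+t. indicator {0..2*pi} t \<partial>lborel) = ennreal (2*pi)" by simp
    finally show ?thesis
      using add_left_mono[OF h, of "ennreal (2*pi)"] assms
      by (subst ennreal_plus) (auto elim: order_trans)
  qed
  then show ?thesis
    using that[of "2*pi + 2/(1-al)"] assms by auto
qed

text \<open>With \<open>b\<close> the argument of \<open>a\<close>, the distance is at least
  \<open>r * |sin (t - b)|\<close>, and the sine is comparable to the distance of \<open>t\<close>
  from the nearest of its zeros \<open>b + k*pi\<close>. The radius enters only through the factor
  \<open>r powr (-al)\<close>.\<close>

lemma circ_powr_bound:
  fixes al :: real
  assumes "0 < al" "al < 1"
  obtains C :: real where "C \<ge> 0"
    "\<And>r a. r > 0 \<Longrightarrow> circ_integrable r (\<lambda>z. norm (z - a) powr (-al))"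
    "\<And>r a. r > 0 \<Longrightarrow> circ_mean r (\<lambda>z. norm (z - a) powr (-al)) \<le> C * r powr (-al)"
proof -
  obtain C where C: "C \<ge> 0"
    "\<And>c. (\<integral>\<^sup>+t\<in>{0..2*pi}. ennreal (\<bar>t - c\<bar> powr (-al)) \<partial>lborel) \<le> ennreal C"
    using nn_integral_powr_bound[OF assms] by blast
  \<comment> \<open>The 5 counts the values of \<open>k\<close>, \<open>3 powr al\<close> comes from
    the sine bound with constant 1/3, and \<open>2*pi\<close> normalizes the mean.\<close>
  define C' where "C' = 3 powr al * 5 * C / (2*pi)"
  have main: "(\<integral>\<^sup>+t. ennreal (norm (of_real r * cis t - a) powr (-al)) \<partial>lebesgue_on {0..2*pi})
       \<le> ennreal (2*pi*C' * r powr (-al))" if r: "r > 0" for r a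
  proof -
    define b where "b = Arg2pi a"
    have a: "a = of_real (norm a) * cis b"
      using Arg2pi_eq[of a] unfolding b_def cis_conv_exp by simp
    have b: "0 \<le> b" "b < 2*pi" using Arg2pi by (auto simp: b_def)
    \<comment> \<open>Since \<open>t - b\<close> lies between -2 pi and 2 pi, the nearest multiple
      \<open>k*pi\<close> has \<open>k\<close> in this range.\<close>
    let ?K = "{-2..2::int}"
    let ?c = "\<lambda>k::int. b + k * pi"
    let ?B = "\<lambda>t. \<Sum>k\<in>?K. (3 powr al * r powr (-al)) * \<bar>t - ?c k\<bar> powr (-al)"
    \<comment> \<open>The parameters \<open>?c k\<close> must be avoided: as
      \<open>0 powr (-al)\<close> is 0, the summand that should dominate vanishes there.\<close>
    have bd: "norm (of_real r * cis t - a) powr (-al) \<le> ?B t" 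
      if t: "t \<in> {0..2*pi}" and nz: "of_real r * cis t \<noteq> a" "\<And>k. k \<in> ?K \<Longrightarrow> t \<noteq> ?c k" for t
    proof -
      define k where "k = round ((t - b) / pi)"
      have k: "\<bar>(t - b)/pi - of_int k\<bar> \<le> 1/2"
        unfolding k_def using of_int_round_abs_le[of "(t-b)/pi"] by (simp add: abs_minus_commute)
      have "(t - b)/pi \<le> 2" "(t - b)/pi > -2"
        using b t by (auto simp: field_simps)
      with k have "real_of_int k < 3" "real_of_int k > -3" by linarith+
      then have kK: "k \<in> ?K" by auto
      have eq: "t - ?c k = pi * ((t - b)/pi - of_int k)" by (simp add: field_simps)
      have small: "\<bar>t - ?c k\<bar> \<le> pi/2"
        unfolding eq abs_mult using mult_left_mono[OF k, of pi] by simp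
      have "\<bar>sin (t - b)\<bar> = \<bar>sin (t - ?c k)\<bar>"
      proof -
        have s0: "sin (of_int k * pi) = 0" unfolding sin_zero_iff_int2 by blast
        have c1: "\<bar>cos (of_int k * pi)\<bar> = 1"
          using sin_cos_squared_add[of "of_int k * pi"] s0 by (simp add: power2_eq_1_iff) auto
        have "sin (t - b) = sin ((t - ?c k) + of_int k * pi)" by simp
        also have "\<dots> = sin (t - ?c k) * cos (of_int k * pi)"
          by (simp only: sin_add s0)
        finally show ?thesis using c1 by (simp add: abs_mult)
      qed
      then have "r * \<bar>sin (t - b)\<bar> \<ge> r * (\<bar>t - ?c k\<bar> / 3)"
        using abs_sin_ge[OF small] r by simp
      then have "norm (of_real r * cis t - a) \<ge> r * (\<bar>t - ?c k\<bar> / 3)"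
        using norm_circ_diff_ge_sin[OF r, where t=t and s="norm a" and b=b] unfolding a[symmetric] by (rule order_trans)
      moreover have "r * (\<bar>t - ?c k\<bar> / 3) > 0" using nz(2)[OF kK] r by simp
      ultimately have "norm (of_real r * cis t - a) powr (-al) \<le> (r * (\<bar>t - ?c k\<bar> / 3)) powr (-al)"
        using assms by (intro powr_mono2') auto
      also have "\<dots> = (3 powr al * r powr (-al)) * \<bar>t - ?c k\<bar> powr (-al)"
        using r by (simp add: powr_mult powr_divide) (simp add: powr_minus divide_inverse)
      also have "\<dots> \<le> ?B t"
        using kK by (intro member_le_sum) auto
      finally show ?thesis .
    qed
    have "(\<integral>\<^sup>+t. ennreal (norm (of_real r * cis t - a) powr (-al)) \<partial>lebesgue_on {0..2*pi})
      = (\<integral>\<^sup>+t. ennreal (norm (of_real r * cis t - a) powr (-al)) * indicator {0..2*pi} t \<partial>lebesgue)"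
      by (subst nn_integral_restrict_space) auto
    also have "\<dots> = (\<integral>\<^sup>+t. ennreal (norm (of_real r * cis t - a) powr (-al)) * indicator {0..2*pi} t \<partial>lborel)"
      by (rule nn_integral_completion)
    also have "\<dots> \<le> (\<integral>\<^sup>+t. (\<Sum>k\<in>?K. ennreal (3 powr al * r powr (-al)) * (ennreal (\<bar>t - ?c k\<bar> powr (-al)) * indicator {0..2*pi} t)) \<partial>lborel)"
    proof (rule nn_integral_mono_AE)
      have fin: "finite (({t\<in>{0..2*pi}. of_real r * cis t \<in> {a}}) \<union> ?c ` ?K)"
        using r finite_cis_eq[of r "{a}"] by auto
      have "AE t in lborel. t \<notin> ({t\<in>{0..2*pi}. of_real r * cis t \<in> {a}}) \<union> ?c ` ?K"
        using fin by (intro AE_not_in finite_imp_null_set_lborel)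
      then show "AE t in lborel. ennreal (norm (of_real r * cis t - a) powr (-al)) * indicator {0..2*pi} t
        \<le> (\<Sum>k\<in>?K. ennreal (3 powr al * r powr (-al)) * (ennreal (\<bar>t - ?c k\<bar> powr (-al)) * indicator {0..2*pi} t))"
      proof eventually_elim
        case (elim t)
        show ?case
        proof (cases "t \<in> {0..2*pi}")
          case True
          have "norm (of_real r * cis t - a) powr (-al) \<le> ?B t"
            using elim True by (intro bd) auto
          then have "ennreal (norm (of_real r * cis t - a) powr (-al)) \<le> ennreal (?B t)"
            by (rule ennreal_leI)
          also have "\<dots> = (\<Sum>k\<in>?K. ennreal ((3 powr al * r powr (-al)) * \<bar>t - ?c k\<bar> powr (-al)))"
            by (rule sum_ennreal[symmetric]) auto
          finally show ?thesis using True by (simp add: ennreal_mult)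
        qed auto
      qed
    qed
    also have "\<dots> = (\<Sum>k\<in>?K. ennreal (3 powr al * r powr (-al)) * (\<integral>\<^sup>+t. (ennreal (\<bar>t - ?c k\<bar> powr (-al)) * indicator {0..2*pi} t) \<partial>lborel))"
      by (subst nn_integral_sum, simp, intro sum.cong refl nn_integral_cmult) simp
    also have "\<dots> \<le> (\<Sum>k\<in>?K. ennreal (3 powr al * r powr (-al)) * ennreal C)"
      by (intro sum_mono mult_left_mono C) auto
    also have "\<dots> = ennreal (5 * (3 powr al * r powr (-al) * C))"
      using C by (simp add: ennreal_mult)
    also have "5 * (3 powr al * r powr (-al) * C) = 2*pi*C' * r powr (-al)"
      by (simp add: C'_def)
    finally show ?thesis .
  qed
  have meas: "(\<lambda>t. norm (of_real r * cis t - a) powr (-al)) \<in> borel_measurable (lebesgue_on {0..2*pi})" for r a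
    using measurable_circ[of "\<lambda>z. norm (z - a) powr (-al)"] by simp
  show ?thesis
  proof
    show "C' \<ge> 0" using C by (simp add: C'_def)
    fix r a assume r: "(r::real) > 0"
    show *: "circ_integrable r (\<lambda>z. norm (z - a) powr (-al))"
      unfolding circ_integrable_def
      by (rule integrableI_nonneg[OF meas]) (use order.strict_trans1[OF main[OF r, of a] ennreal_less_top] in simp_all)
    have "(LINT t|lebesgue_on {0..2*pi}. norm (of_real r * cis t - a) powr (-al)) \<le> 2*pi*C' * r powr (-al)"
    proof -
      have "ennreal (LINT t|lebesgue_on {0..2*pi}. norm (of_real r * cis t - a) powr (-al)) \<le> ennreal (2*pi*C' * r powr (-al))"
        using main[OF r, of a] *
        unfolding circ_integrable_def by (subst nn_integral_eq_integral[symmetric]) simp_all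
      then show ?thesis using \<open>C' \<ge> 0\<close> by (simp add: ennreal_le_iff)
    qed
    then show "circ_mean r (\<lambda>z. norm (z - a) powr (-al)) \<le> C' * r powr (-al)"
      unfolding circ_mean_def by (simp add: field_simps)
  qed
qed

lemma circ_integrable_continuous:
  assumes "r \<ge> 0" "continuous_on (sphere 0 r) g"
  shows "circ_integrable r g"
  unfolding circ_integrable_def
  by (intro continuous_imp_integrable_real continuous_on_compose2[OF assms(2)] continuous_intros)
     (use assms in \<open>auto simp: norm_mult\<close>)

section \<open>Mean values and the Schwarz formula\<close>

text \<open>Cauchy's formula at the centre: on the circle, dw/w is i dt.\<close>

lemma mean_value_has_integral:
  assumes "r > 0" "h holomorphic_on cball 0 r"
  shows "((\<lambda>t. h (of_real r * cis t)) has_integral (2 * of_real pi * h 0)) {0..2*pi}"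
proof -
  have "((\<lambda>u. h u / (u - 0)) has_contour_integral (2 * of_real pi * \<i> * h 0)) (circlepath 0 r)"
    using assms by (intro Cauchy_integral_circlepath_simple) auto
  then have "((\<lambda>t. h (0 + of_real r * cis t) / (0 + of_real r * cis t - 0) * r * \<i> * cis t)
      has_integral (2 * of_real pi * \<i> * h 0)) {0..2*pi}"
    unfolding circlepath_def by (subst (asm) has_contour_integral_part_circlepath_iff) auto
  then have "((\<lambda>t. h (of_real r * cis t) * \<i>) has_integral (2 * of_real pi * \<i> * h 0)) {0..2*pi}"
    using assms by (elim has_integral_eq[rotated]) auto
  then have "((\<lambda>t. h (of_real r * cis t) * \<i> * (-\<i>)) has_integral (2 * of_real pi * \<i> * h 0 * (-\<i>))) {0..2*pi}"
    by (rule has_integral_mult_left)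
  then show ?thesis by (simp add: mult_ac)
qed

lemma circ_mean_Re_holomorphic:
  assumes "r > 0" "h holomorphic_on cball 0 r"
  shows "circ_integrable r (\<lambda>z. Re (h z))" "circ_mean r (\<lambda>z. Re (h z)) = Re (h 0)"
proof -
  show *: "circ_integrable r (\<lambda>z. Re (h z))"
    using assms by (intro circ_integrable_continuous continuous_intros
        continuous_on_subset[OF holomorphic_on_imp_continuous_on]) auto
  have "((\<lambda>t. Re (h (of_real r * cis t))) has_integral (Re (2 * of_real pi * h 0))) {0..2*pi}"
    using has_integral_Re[OF mean_value_has_integral[OF assms]] .
  then show "circ_mean r (\<lambda>z. Re (h z)) = Re (h 0)"
    using * unfolding circ_mean_def circ_integrable_def
    by (simp add: lebesgue_integral_eq_integral integral_unique)
qed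

text \<open>The singularity at 0 is traded for \<open>x powr (-(1/2))\<close>, which
  \<open>circ_powr_bound\<close> makes integrable on every circle; this gives a majorant for the
  logarithm when \<open>a\<close> is on the circle.\<close>

lemma abs_ln_le:
  fixes x :: real
  assumes "x > 0"
  shows "\<bar>ln x\<bar> \<le> x + 2 * x powr (-(1/2))"
proof (cases "x \<ge> 1")
  case True
  then have "\<bar>ln x\<bar> \<le> x" using ln_le_minus_one[of x] by auto
  moreover have "0 \<le> 2 * x powr (-(1/2))" by simp
  ultimately show ?thesis by linarith
next
  case False
  then have "ln (1/x) \<le> (1/x) powr (1/2) / (1/2)"
    using assms by (intro ln_powr_bound) auto
  also have "\<dots> = 2 * x powr (-(1/2))"
    using assms powr_divide[of 1 x "1/2"] powr_minus_divide[of x "1/2"] by simp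
  finally show ?thesis using assms False by (simp add: ln_div)
qed

text \<open>Jensen's formula for a single linear factor. Off the circle, \<open>|z - a|\<close>
  agrees there up to a constant with the modulus of a function that has a holomorphic logarithm on
  the disc; points on the circle are reached by a limit.\<close>

lemma circ_mean_ln_norm_diff:
  assumes r: "r > 0"
  shows "circ_integrable r (\<lambda>z. ln (norm (z - a)))" (is ?A)
    and "circ_mean r (\<lambda>z. ln (norm (z - a))) = ln (max r (norm a))" (is ?B)
proof -
  have inside: "circ_integrable r (\<lambda>z. ln (norm (z - a))) \<and> circ_mean r (\<lambda>z. ln (norm (z - a))) = ln r"
    if a: "norm a < r" for a
  proof -
    \<comment> \<open>For \<open>|z| = r\<close> one has
      \<open>|z - a| = r * |1 - cnj a * z / r^2|\<close>. The only possible zero of the new factor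
      is the mirror image of \<open>a\<close>, outside the disc.\<close>
    let ?h = "\<lambda>z. Ln (1 - cnj a * z / r\<^sup>2)"
    have lt: "norm (cnj a * z / r\<^sup>2) < 1" if "norm z \<le> r" for z
    proof -
      have "norm a * norm z < r * r"
        using mult_left_mono[OF that, of "norm a"] mult_strict_right_mono[OF a r] by simp
      then show ?thesis using r by (simp add: norm_mult norm_divide power2_eq_square)
    qed
    have nz: "1 - cnj a * z / r\<^sup>2 \<notin> \<real>\<^sub>\<le>\<^sub>0" if "norm z \<le> r" for z
    proof
      assume "1 - cnj a * z / r\<^sup>2 \<in> \<real>\<^sub>\<le>\<^sub>0"
      then have "Re (1 - cnj a * z / r\<^sup>2) \<le> 0" by (simp add: complex_nonpos_Reals_iff)
      then show False using lt[OF that] complex_Re_le_cmod[of "cnj a * z / r\<^sup>2"] by simp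
    qed
    have h: "?h holomorphic_on cball 0 r"
      by (intro holomorphic_intros) (use nz r in auto)
    have eq: "ln (norm (z - a)) = Re (?h z) + ln r" if z: "norm z = r" for z
    proof -
      have "z \<noteq> 0" using z r by auto
      have "r\<^sup>2 = z * cnj z" using z by (metis complex_norm_square)
      then have "norm (1 - cnj a * z / r\<^sup>2) = norm (cnj (1 - a / z))"
        using \<open>z \<noteq> 0\<close> by (simp add: divide_simps)
      also have "\<dots> = norm (z - a) / r"
        unfolding complex_mod_cnj using \<open>z \<noteq> 0\<close> z
        by (metis diff_divide_distrib divide_self norm_divide)
      finally have n: "norm (1 - cnj a * z / r\<^sup>2) = norm (z - a) / r" .
      have "1 - cnj a * z / r\<^sup>2 \<noteq> 0" using nz[of z] z by auto
      then have "Re (?h z) = ln (norm (z - a) / r)" "norm (z - a) > 0"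
        using n a z by auto
      then show ?thesis using r by (simp add: ln_div)
    qed
    have m: "circ_integrable r (\<lambda>z. Re (?h z) + ln r)" "circ_mean r (\<lambda>z. Re (?h z) + ln r) = ln r"
      using circ_mean_Re_holomorphic[OF r h] by (simp_all add: circ_integrable_add circ_mean_add)
    have "(\<lambda>t. ln (norm (of_real r * cis t - a))) = (\<lambda>t. Re (?h (of_real r * cis t)) + ln r)"
      using r by (intro ext eq) (simp add: norm_mult)
    then show ?thesis using m unfolding circ_integrable_def circ_mean_def by simp
  qed
  have "?A \<and> ?B"
  proof (cases "norm a" r rule: linorder_cases)
    case less
    then show ?thesis using inside[OF less] by simp
  next
    case greater
    let ?h = "\<lambda>z. Ln (1 - z / a)"
    have [simp]: "a \<noteq> 0" using greater r by auto
    have nz: "1 - z / a \<notin> \<real>\<^sub>\<le>\<^sub>0" if "norm z \<le> r" for z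
    proof
      assume "1 - z / a \<in> \<real>\<^sub>\<le>\<^sub>0"
      then have "Re (1 - z / a) \<le> 0" by (simp add: complex_nonpos_Reals_iff)
      moreover have "norm (z / a) < 1" using that greater by (simp add: norm_divide)
      ultimately show False using complex_Re_le_cmod[of "z / a"] by simp
    qed
    have h: "?h holomorphic_on cball 0 r"
      by (intro holomorphic_intros) (use nz in auto)
    have eq: "ln (norm (z - a)) = Re (?h z) + ln (norm a)" if z: "norm z = r" for z
    proof -
      have n: "norm (1 - z / a) = norm (z - a) / norm a"
        by (metis \<open>a \<noteq> 0\<close> diff_divide_distrib divide_self norm_divide norm_minus_commute)
      have "1 - z / a \<noteq> 0" using nz[of z] z by auto
      then have "Re (?h z) = ln (norm (z - a) / norm a)" "norm (z - a) > 0"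
        using n greater z by auto
      then show ?thesis by (simp add: ln_div)
    qed
    have m: "circ_integrable r (\<lambda>z. Re (?h z) + ln (norm a))" "circ_mean r (\<lambda>z. Re (?h z) + ln (norm a)) = ln (norm a)"
      using circ_mean_Re_holomorphic[OF r h] by (simp_all add: circ_integrable_add circ_mean_add)
    have "(\<lambda>t. ln (norm (of_real r * cis t - a))) = (\<lambda>t. Re (?h (of_real r * cis t)) + ln (norm a))"
      using r by (intro ext eq) (simp add: norm_mult)
    then show ?thesis using m greater unfolding circ_integrable_def circ_mean_def by simp
  next
    case equal
    \<comment> \<open>The points \<open>p n * a\<close> approach \<open>a\<close> radially from
      inside, where the formula is already known.\<close>
    define p where "p = (\<lambda>n::nat. 1 - 1 / real (n + 2))"
    have p: "0 \<le> p n" "p n < 1" for n by (auto simp: p_def)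
    have plim: "p \<longlonglongrightarrow> 1"
      unfolding p_def by real_asymp
    let ?M = "lebesgue_on {0..2*pi}"
    let ?s = "\<lambda>n t. ln (norm (of_real r * cis t - of_real (p n) * a))"
    let ?w = "\<lambda>z. 2 * r + 2 * (2 powr (1/2) * norm (z - a) powr (-(1/2)))"
    have meas: "(\<lambda>t. ln (norm (of_real r * cis t - b))) \<in> borel_measurable ?M" for b
      using measurable_circ[of "\<lambda>z. ln (norm (z - b))"] by simp
    have "circ_integrable r ?w"
      using circ_powr_bound[of "1/2"] r
      by (intro circ_integrable_add circ_integrable_const circ_integrable_cmult) auto
    then have w: "integrable ?M (\<lambda>t. ?w (of_real r * cis t))"
      by (simp add: circ_integrable_def)
    have AE: "AE t in ?M. of_real r * cis t \<notin> {a}"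
      using r by (intro AE_circ_not_in_finite) auto
    have lim: "AE t in ?M. (\<lambda>n. ?s n t) \<longlonglongrightarrow> ln (norm (of_real r * cis t - a))"
      using AE
    proof eventually_elim
      case (elim t)
      have "(\<lambda>n. ?s n t) \<longlonglongrightarrow> ln (norm (of_real r * cis t - of_real 1 * a))"
        using elim by (intro tendsto_intros plim) auto
      then show ?case by simp
    qed
    have bound: "AE t in ?M. norm (?s n t) \<le> ?w (of_real r * cis t)" for n
      using AE
    proof eventually_elim
      case (elim t)
      let ?z = "of_real r * cis t"
      have nz: "norm ?z = r" using r by (simp add: norm_mult)
      have "norm (?z - a) \<le> norm (?z - p n * a) + norm (p n * a - a)"
        by (metis dist_norm dist_triangle)
      moreover have "norm (p n * a - a) = (1 - p n) * r"
      proof -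
        have "of_real (p n) * a - a = of_real (p n - 1) * a" by (simp add: algebra_simps)
        then show ?thesis using p[of n] equal by (simp only: norm_mult norm_of_real) simp
      qed
      moreover have "norm (?z - p n * a) \<ge> norm ?z - norm (p n * a)"
        by (rule norm_triangle_ineq2)
      moreover have "norm (p n * a) = p n * r" using p[of n] equal by (simp add: norm_mult)
      \<comment> \<open>The displacement \<open>(1 - p n) * r\<close> is itself at most
        \<open>|z - p n * a|\<close>, so the triangle inequality loses only a factor 2, the same for
        all \<open>n\<close>.\<close>
      ultimately have half: "norm (?z - a) / 2 \<le> norm (?z - p n * a)"
        using nz by (simp add: algebra_simps)
      moreover have pos: "norm (?z - a) > 0" using elim by simp
      ultimately have pos': "norm (?z - p n * a) > 0" by linarith
      have "norm (?z - p n * a) \<le> norm ?z + norm (p n * a)"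
        by (rule norm_triangle_ineq4)
      also have "\<dots> \<le> 2 * r" using \<open>norm (p n * a) = p n * r\<close> nz p[of n] r by simp
      finally have up: "norm (?z - p n * a) \<le> 2 * r" .
      have "norm (?z - p n * a) powr (-(1/2)) \<le> (norm (?z - a) / 2) powr (-(1/2))"
        using half pos by (intro powr_mono2') auto
      also have "\<dots> = 2 powr (1/2) * norm (?z - a) powr (-(1/2))"
        using powr_divide[of "norm (?z - a)" 2 "-(1/2)"] powr_minus_divide[of "2::real" "1/2"] by simp
      finally show ?case
        using abs_ln_le[OF pos'] up by simp
    qed
    note DC = integral_dominated_convergence[OF meas meas w lim bound]
      integrable_dominated_convergence[OF meas meas w lim bound]
    have "norm (of_real (p n) * a) < r" for n
      using p[of n] equal r by (simp add: norm_mult)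
    then have "(LINT t|?M. ?s n t) = 2*pi * ln r" for n
      using inside[of "of_real (p n) * a"] by (simp add: circ_mean_def field_simps)
    then have "(\<lambda>n. 2*pi * ln r) \<longlonglongrightarrow> (LINT t|?M. ln (norm (of_real r * cis t - a)))"
      using DC(1) by simp
    then have "(LINT t|?M. ln (norm (of_real r * cis t - a))) = 2*pi * ln r"
      using LIMSEQ_unique tendsto_const by blast
    then show ?thesis
      using DC(2) equal by (simp add: circ_mean_def circ_integrable_def)
  qed
  then show ?A ?B by auto
qed

text \<open>
  Cauchy's formula represents the derivative of \<open>u\<close>, while the same kernel integrates the
  complex conjugate of \<open>u\<close> to zero; the sum of the two identities only involves the real part of \<open>u\<close>.
\<close>
lemma norm_deriv_le_circ_mean_Re:
  assumes hol: "u holomorphic_on cball 0 R" and z: "norm z < R"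
  shows "norm (deriv u z) \<le> 2 * R / (R - norm z)\<^sup>2 * circ_mean R (\<lambda>w. \<bar>Re (u w)\<bar>)"
proof -
  have R: "R > 0" using z norm_ge_zero[of z] by linarith
  let ?e = "\<lambda>t. of_real R * cis t"
  have ne: "?e t \<noteq> z" for t using z R by (auto simp: norm_mult)
  have hol': "u holomorphic_on ball 0 R" using hol by (rule holomorphic_on_subset) auto
  have cont: "continuous_on (cball 0 R) u" using hol by (rule holomorphic_on_imp_continuous_on)
  have z': "z \<in> ball 0 R" using z by simp
  note C = Cauchy_derivative_integral_circlepath[OF cont hol' z']
  have "contour_integral (circlepath 0 R) (\<lambda>w. u w / (w - z)\<^sup>2) = 2 * of_real pi * \<i> * deriv u z"
    using DERIV_imp_deriv[OF C(2)] by simp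
  then have "((\<lambda>w. u w / (w - z)\<^sup>2) has_contour_integral (2 * of_real pi * \<i> * deriv u z)) (circlepath 0 R)"
    using has_contour_integral_integral[OF C(1)] by simp
  then have "((\<lambda>t. u (0 + of_real R * cis t) / (0 + of_real R * cis t - z)\<^sup>2 * R * \<i> * cis t)
      has_integral (2 * of_real pi * \<i> * deriv u z)) {0..2*pi}"
    unfolding circlepath_def by (subst (asm) has_contour_integral_part_circlepath_iff) auto
  from has_integral_mult_left[OF this, of "-\<i>"]
  have 1: "((\<lambda>t. u (?e t) * (?e t / (?e t - z)\<^sup>2)) has_integral (2 * of_real pi * deriv u z)) {0..2*pi}"
    by (simp add: mult_ac)
  \<comment> \<open>For \<open>|w| = R\<close> the identity \<open>R^2 = w * cnj w\<close> turns the
    conjugate of this fraction into \<open>w / (w - z)^2\<close>. Its singularity is the mirror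
    image of \<open>z\<close>, outside the disc, and the factor \<open>w\<close> makes the value at
    the centre 0.\<close>
  let ?phi = "\<lambda>w. u w * (complex_of_real (R\<^sup>2) * w / (complex_of_real (R\<^sup>2) - cnj z * w)\<^sup>2)"
  have nz: "complex_of_real (R\<^sup>2) - cnj z * w \<noteq> 0" if "norm w \<le> R" for w
  proof
    assume "complex_of_real (R\<^sup>2) - cnj z * w = 0"
    then have "norm (of_real (R\<^sup>2) :: complex) = norm (cnj z * w)" by simp
    then have "R * R = norm z * norm w" using R by (simp add: norm_mult power2_eq_square)
    moreover have "norm z * norm w \<le> norm z * R" using that by (simp add: mult_left_mono)
    moreover have "norm z * R < R * R" using z R by simp
    ultimately show False by simp
  qed
  have "?phi holomorphic_on cball 0 R"
    by (intro holomorphic_intros hol) (use nz in auto)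
  from mean_value_has_integral[OF R this]
  have "((\<lambda>t. ?phi (?e t)) has_integral 0) {0..2*pi}" by simp
  from has_integral_linear[OF this bounded_linear_cnj]
  have "((\<lambda>t. cnj (?phi (?e t))) has_integral 0) {0..2*pi}" by (simp add: o_def)
  moreover have "cnj (?phi (?e t)) = cnj (u (?e t)) * (?e t / (?e t - z)\<^sup>2)" for t
  proof -
    have R2: "(of_real R)\<^sup>2 = ?e t * cnj (?e t)"
      by (simp add: cis_cnj cis_mult power2_eq_square)
    have e0: "cnj (?e t) \<noteq> 0" using R by simp
    have "cnj (complex_of_real (R\<^sup>2) * ?e t / (complex_of_real (R\<^sup>2) - cnj z * ?e t)\<^sup>2) = (of_real R)\<^sup>2 * cnj (?e t) / ((of_real R)\<^sup>2 - z * cnj (?e t))\<^sup>2"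
      by simp
    also have "\<dots> = (?e t * cnj (?e t) * cnj (?e t)) / ((?e t - z) * cnj (?e t))\<^sup>2"
      by (simp only: R2 left_diff_distrib)
    also have "\<dots> = ?e t / (?e t - z)\<^sup>2"
      using e0 ne[of t] by (simp add: power2_eq_square del: complex_cnj_mult complex_cnj_zero_iff)
    finally show ?thesis by (simp only: complex_cnj_mult)
  qed
  ultimately have 2: "((\<lambda>t. cnj (u (?e t)) * (?e t / (?e t - z)\<^sup>2)) has_integral 0) {0..2*pi}"
    by (simp only:)
  have 3: "((\<lambda>t. 2 * of_real (Re (u (?e t))) * (?e t / (?e t - z)\<^sup>2)) has_integral (2 * of_real pi * deriv u z)) {0..2*pi}"
    using has_integral_add[OF 1 2] by (simp only: distrib_right[symmetric] complex_add_cnj add_0_right) simp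
  let ?c = "2 * R / (R - norm z)\<^sup>2"
  have ci: "circ_integrable R (\<lambda>w. \<bar>Re (u w)\<bar>)"
    by (intro circ_integrable_abs circ_mean_Re_holomorphic R hol)
  then have hi: "((\<lambda>t. \<bar>Re (u (?e t))\<bar>) has_integral (2 * pi * circ_mean R (\<lambda>w. \<bar>Re (u w)\<bar>))) {0..2*pi}"
    unfolding circ_integrable_def circ_mean_def
    using has_integral_integral_lebesgue_on[of "{0..2*pi}" "\<lambda>t. \<bar>Re (u (?e t))\<bar>"] by simp
  have "norm (integral {0..2*pi} (\<lambda>t. 2 * of_real (Re (u (?e t))) * (?e t / (?e t - z)\<^sup>2)))
      \<le> integral {0..2*pi} (\<lambda>t. ?c * \<bar>Re (u (?e t))\<bar>)"
  proof (rule integral_norm_bound_integral)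
    show "(\<lambda>t. 2 * of_real (Re (u (?e t))) * (?e t / (?e t - z)\<^sup>2)) integrable_on {0..2*pi}"
      using 3 by (rule has_integral_integrable)
    show "(\<lambda>t. ?c * \<bar>Re (u (?e t))\<bar>) integrable_on {0..2*pi}"
      using has_integral_mult_right[OF hi] by (rule has_integral_integrable)
    fix t
    have "norm (?e t - z) \<ge> R - norm z"
      using norm_triangle_ineq2[of "?e t" z] R by (simp add: norm_mult)
    then have "R / (norm (?e t - z))\<^sup>2 \<le> R / (R - norm z)\<^sup>2"
      using z R by (intro divide_left_mono power_mono) (auto intro!: mult_pos_pos zero_less_power simp: ne)
    then have "2 * \<bar>Re (u (?e t))\<bar> * (R / (norm (?e t - z))\<^sup>2) \<le> 2 * \<bar>Re (u (?e t))\<bar> * (R / (R - norm z)\<^sup>2)"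
      by (intro mult_left_mono) auto
    then show "norm (2 * of_real (Re (u (?e t))) * (?e t / (?e t - z)\<^sup>2)) \<le> ?c * \<bar>Re (u (?e t))\<bar>"
      using R by (simp add: norm_mult norm_divide norm_power mult_ac)
  qed
  then have "norm (2 * of_real pi * deriv u z) \<le> ?c * (2 * pi * circ_mean R (\<lambda>w. \<bar>Re (u w)\<bar>))"
    using integral_unique[OF 3] integral_unique[OF hi] by simp
  then have "2 * pi * norm (deriv u z) \<le> 2 * pi * (?c * circ_mean R (\<lambda>w. \<bar>Re (u w)\<bar>))"
    by (simp add: norm_mult mult_ac)
  then show ?thesis by (subst (asm) mult_le_cancel_left_pos) auto
qed

section \<open>Jensen's formula for meromorphic functions\<close>

lemma ln_power_int: "x > 0 \<Longrightarrow> ln (x powi n) = of_int n * ln (x::real)"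
  by (cases n rule: int_cases2) (auto simp: power_int_minus ln_inverse ln_realpow)

text \<open>The values at singularities are arbitrary, but these points form a sparse, hence
  countable, set, and \<open>f\<close> is continuous off it.\<close>

lemma meromorphic_imp_borel_measurable:
  assumes mero: "f meromorphic_on UNIV"
  shows "f \<in> borel_measurable borel"
proof (rule borel_measurable_continuous_countable_exceptions)
  let ?X = "{z. \<not> f analytic_on {z}}"
  have sp: "?X sparse_in UNIV"
    using meromorphic_on_imp_sparse_singularities[OF mero] .
  then show "countable ?X" using sparse_imp_countable[of UNIV ?X] by simp
  have "f analytic_on - ?X"
    by (subst analytic_on_analytic_at) auto
  then show "continuous_on (- ?X) f"
    by (intro holomorphic_on_imp_continuous_on analytic_imp_holomorphic)
qed

text \<open>\<open>meromorphic_on\<close> leaves the values on a sparse set free, so "not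
  identically zero" has to be read modulo sparse sets.\<close>

locale nonzero_meromorphic =
  fixes f :: "complex \<Rightarrow> complex"
  assumes mero: "f meromorphic_on UNIV"
    and not_zero: "\<not> (\<forall>\<^sub>\<approx>z. f z = 0)"
begin

text \<open>Zeros and poles are kept together, distinguished by the sign of \<open>zorder\<close>,
  so that one signed sum handles both. The disc is closed to make the set finite by
  compactness.\<close>

definition zp_set :: "real \<Rightarrow> complex set" where
  "zp_set K = {a \<in> cball 0 K. zorder f a \<noteq> 0}"

text \<open>The weight with which a zero or pole \<open>a\<close> enters Jensen's formula on the circle of radius \<open>R\<close>.\<close>
definition jweight :: "real \<Rightarrow> complex \<Rightarrow> real" where
  "jweight R a = (if a = 0 then ln R else ln (max R (norm a)) - ln (norm a))"

text \<open>The logarithm of the modulus of the leading Laurent coefficient at 0. It refers to no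
  disc, so the same constant serves for all radii.\<close>

definition jensen_const :: real where
  "jensen_const = ln (Lim (at 0) (\<lambda>z. norm (f z) * norm z powi (- zorder f 0)))"

lemma mero_at: "f meromorphic_on {z}"
  using mero by (rule meromorphic_on_subset) auto

lemma iso_at: "isolated_singularity_at f z"
  using meromorphic_on_isolated_singularity[OF mero_at] .

lemma eventually_nonzero: "eventually (\<lambda>z. f z \<noteq> 0) (cosparse UNIV)"
  using meromorphic_imp_constant_or_avoid[OF mero, of 0] not_zero by auto

lemma eventually_nonzero_at: "eventually (\<lambda>z. f z \<noteq> 0) (at z)"
  using eventually_cosparse_imp_eventually_at[OF eventually_nonzero, of z UNIV] by simp

lemma frequently_nonzero_at: "frequently (\<lambda>z. f z \<noteq> 0) (at z)"
  by (rule eventually_frequently[OF _ eventually_nonzero_at]) auto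

lemma is_pole_iff_zorder: "is_pole f z \<longleftrightarrow> zorder f z < 0"
  using isolated_pole_imp_neg_zorder[OF iso_at] zorder_neg_imp_is_pole[OF mero_at eventually_nonzero_at] by blast

lemma cosparse_finite_cball:
  assumes "eventually P (cosparse (UNIV :: complex set))"
  shows "finite {z\<in>cball 0 K. \<not> P z}"
proof -
  have "{z. \<not> P z} sparse_in cball 0 K"
    using assms unfolding eventually_cosparse by (rule sparse_in_subset) auto
  then have "finite (cball 0 K \<inter> {z. \<not> P z})"
    by (rule sparse_in_compact_finite) auto
  then show ?thesis by (simp add: Int_def)
qed

lemma finite_zp_set: "finite (zp_set K)"
proof -
  have "eventually (\<lambda>z. zorder f z = 0) (cosparse UNIV)"
    using meromorphic_on_imp_not_pole_cosparse[OF mero] meromorphic_on_imp_not_zero_cosparse[OF mero]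
    by eventually_elim (rule not_pole_not_isolated_zero_imp_zorder_eq_0[OF mero_at _ _ frequently_nonzero_at])
  from cosparse_finite_cball[OF this, of K] show ?thesis
    by (simp add: zp_set_def)
qed

lemma borel_measurable_f: "f \<in> borel_measurable borel"
  using mero by (rule meromorphic_imp_borel_measurable)

lemma zorder_linear_powi: "zorder (\<lambda>w. (w - a) powi n) z = (if z = a then n else 0)"
proof (cases "z = a")
  case True
  then show ?thesis
    by (auto intro!: zorder_eqI[where S=UNIV and g="\<lambda>_. 1"])
next
  case False
  then show ?thesis
    by (auto intro!: zorder_eq_0I analytic_intros simp: power_int_eq_0_iff)
qed

text \<open>Multiplying \<open>f\<close> by \<open>p\<close> cancels all zeros and poles in the
  closed disc. The product has order 0 there, so removing its singularities leaves a zero-free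
  holomorphic function, which has a logarithm \<open>u\<close>. Besides zeros and poles,
  \<open>E\<close> collects the points where a value had to be corrected.\<close>

lemma factorization:
  assumes "K > 0"
  obtains u E where "u holomorphic_on ball 0 K" "finite E" "zp_set K \<subseteq> E"
    "\<And>z. z \<in> ball 0 K - E \<Longrightarrow> f z = exp (u z) * (\<Prod>a\<in>zp_set K. (z - a) powi zorder f a)"
proof -
  let ?S = "zp_set K"
  define p where "p = (\<lambda>z. \<Prod>a\<in>?S. (z - a) powi (- zorder f a))"
  define g where "g = (\<lambda>z. f z * p z)"
  have pm: "p meromorphic_on A" for A
    unfolding p_def by (intro meromorphic_intros)
  have gm: "g meromorphic_on A" for A
    unfolding g_def by (intro meromorphic_intros pm meromorphic_on_subset[OF mero]) auto
  have pnz': "p z \<noteq> 0" if "z \<notin> ?S" for z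
    using that finite_zp_set by (auto simp: p_def power_int_eq_0_iff)
  have pnz: "eventually (\<lambda>z. p z \<noteq> 0) (at z)" for z
  proof -
    have "eventually (\<lambda>z. z \<notin> ?S) (at z)"
      using islimpt_finite[OF finite_zp_set, of z K] by (simp add: islimpt_conv_frequently_at frequently_def)
    then show ?thesis by eventually_elim (rule pnz')
  qed
  have gnz: "frequently (\<lambda>z. g z \<noteq> 0) (at z)" for z
    using eventually_conj[OF pnz eventually_nonzero_at, of z]
    by (intro eventually_frequently) (auto elim!: eventually_mono simp: g_def)
  have zg: "zorder g z = 0" if "z \<in> cball 0 K" for z
  proof -
    have "zorder g z = zorder f z + zorder p z"
      unfolding g_def
      by (intro zorder_mult mero_at frequently_nonzero_at pm eventually_frequently[OF _ pnz]) auto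
    also have "zorder p z = (\<Sum>a\<in>?S. zorder (\<lambda>w. (w - a) powi (- zorder f a)) z)"
      unfolding p_def by (rule zorder_prod) (use pnz in \<open>auto simp: p_def intro!: meromorphic_intros\<close>)
    also have "\<dots> = (\<Sum>a\<in>?S. if z = a then - zorder f a else 0)"
      by (simp only: zorder_linear_powi)
    also have "\<dots> = (if z \<in> ?S then - zorder f z else 0)"
      using finite_zp_set by simp
    finally show ?thesis using that by (auto simp: zp_set_def)
  qed
  have gis: "isolated_singularity_at g z" "not_essential g z" for z
    using meromorphic_on_isolated_singularity[OF gm] meromorphic_on_not_essential[OF gm] by auto
  define h where "h = remove_sings g"
  have h: "h analytic_on {z}" "h z \<noteq> 0" if z: "z \<in> cball 0 K" for z
  proof -
    have "\<not> is_pole g z"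
      using isolated_pole_imp_neg_zorder[OF gis(1)] zg[OF z] by force
    then obtain c where "g \<midarrow>z\<rightarrow> c"
      using gis(2)[of z] unfolding not_essential_def by auto
    then show an: "h analytic_on {z}"
      unfolding h_def by (rule remove_sings_analytic_at[OF gis(1)])
    have "frequently (\<lambda>z. h z \<noteq> 0) (at z)"
      using gnz[of z] eventually_remove_sings_eq_at[OF gis(1), of z] unfolding h_def
      by (elim frequently_rev_mp) (auto elim: eventually_mono)
    then show "h z \<noteq> 0"
      using zorder_eq_0_iff[OF an] zg[OF z] gis(1)[of z] by (simp add: h_def)
  qed
  have hol: "h holomorphic_on ball 0 K"
    by (intro analytic_imp_holomorphic analytic_on_analytic_at[THEN iffD2]) (use h in auto)
  obtain u where u: "u holomorphic_on ball 0 K" "\<And>z. z \<in> ball 0 K \<Longrightarrow> exp (u z) = h z"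
    by (rule holomorphic_logarithm_exists[OF convex_ball open_ball hol, of 0]) (use h assms in auto)
  define E where "E = ?S \<union> {z \<in> cball 0 K. \<not> remove_sings g z = g z}"
  have "finite E"
    unfolding E_def using finite_zp_set cosparse_finite_cball[OF eventually_remove_sings_eq[OF gm]] by blast
  moreover have "f z = exp (u z) * (\<Prod>a\<in>?S. (z - a) powi zorder f a)" if z: "z \<in> ball 0 K - E" for z
  proof -
    have "exp (u z) = f z * p z"
      using u(2)[of z] z by (auto simp: E_def h_def g_def)
    moreover have "p z * (\<Prod>a\<in>?S. (z - a) powi zorder f a) = 1"
      unfolding p_def prod.distrib[symmetric]
      by (rule prod.neutral) (use z in \<open>auto simp: E_def power_int_minus field_simps\<close>)
    ultimately show ?thesis by (simp add: mult.assoc)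
  qed
  ultimately show ?thesis
    using that[OF u(1), of E] by (auto simp: E_def)
qed

text \<open>Cancelling the order at 0 leaves \<open>exp (u z)\<close> times the factors with
  \<open>a\<close> nonzero, which is continuous and nonzero at 0; the limit is its value
  there.\<close>

lemma jensen_const_eq:
  assumes K: "K > 0" and u: "u holomorphic_on ball 0 K" and E: "finite E"
    and f: "\<And>z. z \<in> ball 0 K - E \<Longrightarrow> f z = exp (u z) * (\<Prod>a\<in>zp_set K. (z - a) powi zorder f a)"
  shows "jensen_const = Re (u 0) + (\<Sum>a\<in>zp_set K - {0}. zorder f a * ln (norm a))"
proof -
  let ?S = "zp_set K"
  let ?q = "\<lambda>z. norm (exp (u z) * (\<Prod>a\<in>?S - {0}. (z - a) powi zorder f a))"
  have "isCont u 0"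
    using holomorphic_on_imp_continuous_on[OF u] K by (simp add: continuous_on_eq_continuous_at)
  then have "(u \<longlongrightarrow> u 0) (at 0)" by (simp add: isCont_def)
  then have lim: "(?q \<longlongrightarrow> ?q 0) (at 0)"
    by (intro tendsto_intros) auto
  have ev: "eventually (\<lambda>z. norm (f z) * norm z powi (- zorder f 0) = ?q z) (at 0)"
  proof -
    have 1: "eventually (\<lambda>z. z \<notin> E) (at 0)"
      using islimpt_finite[OF E, of 0] by (simp add: islimpt_conv_frequently_at frequently_def)
    have 2: "eventually (\<lambda>z. z \<in> ball 0 K - {0}) (at 0)"
      using K by (intro eventually_at_in_open) auto
    from 1 2 show ?thesis
    proof eventually_elim
      case (elim z)
      have "(\<Prod>a\<in>?S. (z - a) powi zorder f a) = z powi zorder f 0 * (\<Prod>a\<in>?S - {0}. (z - a) powi zorder f a)"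
      proof (cases "0 \<in> ?S")
        case True
        then show ?thesis by (subst prod.remove[OF finite_zp_set True]) simp
      next
        case False
        then have "zorder f 0 = 0" using K by (auto simp: zp_set_def)
        then show ?thesis using False by simp
      qed
      then show ?case
        using f[of z] elim by (simp add: norm_mult norm_power_int power_int_minus field_simps)
    qed
  qed
  have "((\<lambda>z. norm (f z) * norm z powi (- zorder f 0)) \<longlongrightarrow> ?q 0) (at 0)"
    using lim ev by (simp add: tendsto_cong)
  then have "jensen_const = ln (?q 0)"
    unfolding jensen_const_def by (subst tendsto_Lim) auto
  also have "\<dots> = Re (u 0) + (\<Sum>a\<in>?S - {0}. zorder f a * ln (norm a))"
    using finite_zp_set
    by (simp add: norm_mult prod_norm[symmetric] norm_power_int ln_mult)
       (subst ln_prod; auto simp: power_int_eq_0_iff ln_power_int intro!: sum.cong)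
  finally show ?thesis .
qed

text \<open>The mean is computed factor by factor: the mean value property for \<open>Re u\<close>,
  and the formula for a single linear factor. Passing to \<open>jensen_const\<close> confines the
  dependence on \<open>R\<close> to the weights.\<close>

lemma jensen:
  assumes R: "0 < R" "R < K" and u: "u holomorphic_on ball 0 K" and E: "finite E" "zp_set K \<subseteq> E"
    and f: "\<And>z. z \<in> ball 0 K - E \<Longrightarrow> f z = exp (u z) * (\<Prod>a\<in>zp_set K. (z - a) powi zorder f a)"
  shows "z \<in> ball 0 K - E \<Longrightarrow> ln (norm (f z)) = Re (u z) + (\<Sum>a\<in>zp_set K. zorder f a * ln (norm (z - a)))"
    and "circ_integrable R (\<lambda>z. ln (norm (f z)))"
    and "circ_mean R (\<lambda>z. ln (norm (f z))) = jensen_const + (\<Sum>a\<in>zp_set K. zorder f a * jweight R a)"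
proof -
  let ?S = "zp_set K"
  have ln_eq: "ln (norm (f z)) = Re (u z) + (\<Sum>a\<in>?S. zorder f a * ln (norm (z - a)))" if z: "z \<in> ball 0 K - E" for z
  proof -
    have "z - a \<noteq> 0" if "a \<in> ?S" for a using that z E by auto
    then show ?thesis
      unfolding f[OF z] using finite_zp_set
      by (simp add: norm_mult prod_norm[symmetric] norm_power_int ln_mult ln_prod ln_power_int)
  qed
  then show "z \<in> ball 0 K - E \<Longrightarrow> ln (norm (f z)) = Re (u z) + (\<Sum>a\<in>?S. zorder f a * ln (norm (z - a)))" .
  \<comment> \<open>Nothing is known about \<open>u\<close> outside the ball, so it is cut off to
    obtain a Borel function; the circle lies where the indicator is 1.\<close>
  let ?g = "\<lambda>z. indicator (ball 0 K) z * Re (u z) + (\<Sum>a\<in>?S. zorder f a * ln (norm (z - a)))"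
  have uR: "u holomorphic_on cball 0 R"
    using u by (rule holomorphic_on_subset) (use R in auto)
  have "continuous_on (ball 0 K) (\<lambda>z. Re (u z))"
    by (intro continuous_intros holomorphic_on_imp_continuous_on u)
  then have "(\<lambda>z. indicator (ball 0 K) z *\<^sub>R Re (u z)) \<in> borel_measurable borel"
    by (intro borel_measurable_continuous_on_indicator) auto
  then have gm: "?g \<in> borel_measurable borel" by simp
  have fm: "(\<lambda>z. ln (norm (f z))) \<in> borel_measurable borel"
    using borel_measurable_f by simp
  have ind: "(\<lambda>z. indicator (ball 0 K) (complex_of_real R * cis z) * Re (u (complex_of_real R * cis z)))
     = (\<lambda>z. Re (u (complex_of_real R * cis z)))"
    using R by (auto simp: indicator_def norm_mult)
  have uc: "circ_integrable R (\<lambda>z. indicator (ball 0 K) z * Re (u z))"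
    "circ_mean R (\<lambda>z. indicator (ball 0 K) z * Re (u z)) = Re (u 0)"
    using circ_mean_Re_holomorphic[OF R(1) uR] unfolding circ_integrable_def circ_mean_def ind by auto
  have lc: "circ_integrable R (\<lambda>z. ln (norm (z - a)))" 
      "circ_mean R (\<lambda>z. ln (norm (z - a))) = ln (max R (norm a))" for a
    using circ_mean_ln_norm_diff[OF R(1)] by auto
  have gi: "circ_integrable R ?g"
    by (intro circ_integrable_add uc circ_integrable_sum circ_integrable_cmult lc)
  have eq: "ln (norm (f z)) = ?g z" if "norm z = \<bar>R\<bar>" "z \<notin> E" for z
    using ln_eq[of z] that R by simp
  note cong = circ_cong_AE[OF _ fm gm E(1) eq, of R]
  show "circ_integrable R (\<lambda>z. ln (norm (f z)))"
    using cong(2) gi R by simp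
  have "circ_mean R (\<lambda>z. ln (norm (f z))) = circ_mean R ?g"
    using cong(1) R by simp
  also have "\<dots> = Re (u 0) + (\<Sum>a\<in>?S. zorder f a * ln (max R (norm a)))"
    by (simp add: circ_mean_add circ_mean_sum uc circ_mean_cmult lc circ_integrable_cmult circ_integrable_sum)
  also have "\<dots> = jensen_const + (\<Sum>a\<in>?S. zorder f a * jweight R a)"
  proof -
    have "(\<Sum>a\<in>?S. zorder f a * jweight R a) 
        = (\<Sum>a\<in>?S. zorder f a * ln (max R (norm a)) - (if a = 0 then 0 else zorder f a * ln (norm a)))"
      using R by (intro sum.cong) (auto simp: jweight_def algebra_simps)
    also have "\<dots> = (\<Sum>a\<in>?S. zorder f a * ln (max R (norm a))) - (\<Sum>a\<in>?S. if a = 0 then 0 else zorder f a * ln (norm a))"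
      by (rule sum_subtractf)
    also have "(\<Sum>a\<in>?S. if a = 0 then 0 else zorder f a * ln (norm a)) = (\<Sum>a\<in>?S - {0}. zorder f a * ln (norm a))"
      using finite_zp_set by (intro sum.mono_neutral_cong_right) auto
    finally show ?thesis
      using jensen_const_eq[OF _ u E(1) f] R by simp
  qed
  finally show "circ_mean R (\<lambda>z. ln (norm (f z))) = jensen_const + (\<Sum>a\<in>?S. zorder f a * jweight R a)" .
qed

text \<open>A pole \<open>a\<close> other than 0 contributes the integral of 1/t from
  \<open>|a|\<close> to \<open>R\<close>. A pole at 0 is subtracted in the integrand and returns
  through the \<open>ln R\<close> term. In both cases the coefficient is
  \<open>jweight\<close>.\<close>

lemma pole_counting_eq:
  assumes R: "0 < R" "R < K"
  shows "pole_counting R f = (\<Sum>a | a \<in> zp_set K \<and> zorder f a < 0. - zorder f a * jweight R a)"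
proof -
  define P where "P = {a \<in> zp_set K. zorder f a < 0}"
  have finP: "finite P" unfolding P_def using finite_zp_set by simp
  have cnt: "pole_count t f = (\<Sum>a\<in>P. if norm a \<le> t then - zorder f a else 0)" if "t \<le> K" for t
  proof -
    have "{z. norm z \<le> t \<and> is_pole f z} = {a\<in>P. norm a \<le> t}"
      using that by (auto simp: P_def zp_set_def is_pole_iff_zorder)
    then show ?thesis
      unfolding pole_count_def of_int_sum using finP by (simp add: sum.inter_filter) (auto intro: sum.cong)
  qed
  have cnt0: "pole_count 0 f = (\<Sum>a\<in>P. if a = 0 then - zorder f a else 0)"
    using cnt[of 0] R by simp
  have base: "((\<lambda>t. if norm a \<le> t then 1 / t else 0) has_integral jweight R a) {0..R}" if "a \<noteq> 0" for a :: complex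
  proof (cases "norm a \<le> R")
    case True
    have pos: "t > 0" if "norm a \<le> t" for t
      using \<open>a \<noteq> 0\<close> that by (meson order.strict_trans2 zero_less_norm_iff)
    have "((\<lambda>t. 1 / t) has_integral (ln R - ln (norm a))) {norm a..R}"
      using True that R pos
      by (intro fundamental_theorem_of_calculus)
         (auto intro!: derivative_eq_intros simp: has_real_derivative_iff_has_vector_derivative[symmetric])
    then have "((\<lambda>t. if t \<in> {norm a..R} then 1 / t else 0) has_integral (ln R - ln (norm a))) {0..R}"
      by (subst has_integral_restrict) auto
    then show ?thesis
      using True that by (elim has_integral_eq_rhs[OF has_integral_eq[rotated]]) (auto simp: jweight_def max_def)
  next
    case False
    then have "((\<lambda>t. 0) has_integral jweight R a) {0..R}"
      using that by (simp add: jweight_def max_def)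
    then show ?thesis
      by (rule has_integral_eq[rotated]) (use False in auto)
  qed
  have "((\<lambda>t. \<Sum>a\<in>P. (if a = 0 then 0 else - zorder f a) * (if norm a \<le> t then 1 / t else 0)) has_integral
          (\<Sum>a\<in>P. (if a = 0 then 0 else - zorder f a) * jweight R a)) {0..R}"
  proof (intro has_integral_sum finP)
    fix a
    show "((\<lambda>t. real_of_int (if a = 0 then 0 else - zorder f a) * (if norm a \<le> t then 1 / t else 0)) has_integral
          real_of_int (if a = 0 then 0 else - zorder f a) * jweight R a) {0..R}"
      using has_integral_mult_right[OF base, of a "real_of_int (- zorder f a)"] by (cases "a = 0") auto
  qed
  moreover have "(\<Sum>a\<in>P. (if a = 0 then 0 else - zorder f a) * (if norm a \<le> t then 1 / t else 0))
     = (pole_count t f - pole_count 0 f) / t" if "t \<in> {0..R}" for t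
  proof -
    have "t \<le> K" using that R by simp
    show ?thesis
      unfolding cnt[OF \<open>t \<le> K\<close>] cnt0 of_int_sum sum_subtractf[symmetric] sum_divide_distrib
      using that by (intro sum.cong) auto
  qed
  ultimately have "((\<lambda>t. (pole_count t f - pole_count 0 f) / t) has_integral
      (\<Sum>a\<in>P. (if a = 0 then 0 else - zorder f a) * jweight R a)) {0..R}"
    by (rule has_integral_eq[rotated])
  then have "pole_counting R f = (\<Sum>a\<in>P. (if a = 0 then 0 else - zorder f a) * jweight R a) + pole_count 0 f * ln R"
    unfolding pole_counting_def by (simp add: integral_unique)
  also have "\<dots> = (\<Sum>a\<in>P. - zorder f a * jweight R a)"
    unfolding cnt0 of_int_sum sum_distrib_right sum.distrib[symmetric]
    by (intro sum.cong) (auto simp: jweight_def)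
  finally show ?thesis by (simp add: P_def)
qed

end

section \<open>Proximity of the difference quotient\<close>

text \<open>At 0 the equation rests on \<open>ln 0 = 0\<close>.\<close>

lemma log_plus_eq_max: "x \<ge> 0 \<Longrightarrow> log_plus x = max 0 (ln x)"
  by (cases "x = 0") (auto simp: log_plus_def max_def)

lemma log_plus_nonneg: "log_plus x \<ge> 0"
  by (simp add: log_plus_def)

lemma borel_measurable_log_plus [measurable]: "log_plus \<in> borel_measurable borel"
  unfolding log_plus_def by measurable

lemma tendsto_log_plus: "(g \<longlongrightarrow> l) F \<Longrightarrow> ((\<lambda>x. log_plus (g x)) \<longlongrightarrow> log_plus l) F"
  unfolding log_plus_def by (intro tendsto_intros) auto

text \<open>Comparing each \<open>g n\<close> with \<open>min (g n) G'\<close> reduces this to the usual dominated convergence theorem.\<close>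
lemma generalized_dominated_convergence:
  fixes g :: "nat \<Rightarrow> 'a \<Rightarrow> real"
  assumes gm: "\<And>n. g n \<in> borel_measurable M" "g' \<in> borel_measurable M"
    and Gi: "\<And>n. integrable M (G n)" "integrable M G'"
    and bd: "\<And>n. AE x in M. 0 \<le> g n x" "\<And>n. AE x in M. g n x \<le> G n x"
    and lim: "AE x in M. (\<lambda>n. g n x) \<longlonglongrightarrow> g' x" "AE x in M. (\<lambda>n. G n x) \<longlonglongrightarrow> G' x"
    and int: "(\<lambda>n. integral\<^sup>L M (G n)) \<longlonglongrightarrow> integral\<^sup>L M G'"
  shows "integrable M g'" "(\<lambda>n. integral\<^sup>L M (g n)) \<longlonglongrightarrow> integral\<^sup>L M g'"
proof -
  note [measurable] = gm borel_measurable_integrable[OF Gi(1)] borel_measurable_integrable[OF Gi(2)]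
  have ev: "AE x in M. (\<forall>n. 0 \<le> g n x \<and> g n x \<le> G n x) \<and> (\<lambda>n. g n x) \<longlonglongrightarrow> g' x \<and> (\<lambda>n. G n x) \<longlonglongrightarrow> G' x"
    using bd lim by (simp add: AE_conj_iff AE_all_countable)
  have lim1: "AE x in M. (\<lambda>n. min (g n x) (G' x)) \<longlonglongrightarrow> g' x"
    using ev
  proof eventually_elim
    case (elim x)
    then have "g' x \<le> G' x" by (auto intro: LIMSEQ_le)
    then show ?case using tendsto_min[of "\<lambda>n. g n x" "g' x" _ "\<lambda>_. G' x" "G' x"] elim by (simp add: min_absorb1)
  qed
  have lim2: "AE x in M. (\<lambda>n. min (G n x) (G' x)) \<longlonglongrightarrow> G' x"
    using ev
  proof eventually_elim
    case (elim x)
    then show ?case using tendsto_min[of "\<lambda>n. G n x" "G' x" _ "\<lambda>_. G' x" "G' x"] by simp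
  qed
  have b1: "AE x in M. norm (min (g n x) (G' x)) \<le> G' x" for n
    using ev
  proof eventually_elim
    case (elim x)
    then have "0 \<le> G' x" by (intro LIMSEQ_le_const[of "\<lambda>n. G n x"]) (auto intro: order_trans)
    then show ?case using elim by (auto simp: min_def)
  qed
  have b2: "AE x in M. norm (min (G n x) (G' x)) \<le> G' x" for n
    using ev
  proof eventually_elim
    case (elim x)
    then have "0 \<le> G' x" by (intro LIMSEQ_le_const[of "\<lambda>n. G n x"]) (auto intro: order_trans)
    moreover have "0 \<le> G n x" using elim by (meson order_trans)
    ultimately show ?case by (auto simp: min_def)
  qed
  have m1: "(\<lambda>x. min (g n x) (G' x)) \<in> borel_measurable M" and m2: "(\<lambda>x. min (G n x) (G' x)) \<in> borel_measurable M" for n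
    by measurable
  note D1 = integral_dominated_convergence[OF gm(2) m1 Gi(2) lim1 b1]
  note D2 = integral_dominated_convergence[OF borel_measurable_integrable[OF Gi(2)] m2 Gi(2) lim2 b2]
  show "integrable M g'"
    by (rule integrable_dominated_convergence[OF gm(2) m1 Gi(2) lim1 b1])
  have gi: "integrable M (g n)" for n
  proof (rule Bochner_Integration.integrable_bound[OF Gi(1)[of n] gm(1)])
    show "AE x in M. norm (g n x) \<le> norm (G n x)"
      using bd(1)[of n] bd(2)[of n] by eventually_elim simp
  qed
  have i1: "integrable M (\<lambda>x. min (g n x) (G' x))" and i2: "integrable M (\<lambda>x. min (G n x) (G' x))" for n
    using gi Gi by (auto intro: integrable_min)
  have z: "(\<lambda>n. integral\<^sup>L M (G n) - (LINT x|M. min (G n x) (G' x))) \<longlonglongrightarrow> integral\<^sup>L M G' - integral\<^sup>L M G'"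
    by (intro tendsto_diff int D2)
  have "(\<lambda>n. integral\<^sup>L M (g n) - (LINT x|M. min (g n x) (G' x))) \<longlonglongrightarrow> 0"
  proof (rule tendsto_sandwich[OF _ _ tendsto_const])
    show "(\<lambda>n. integral\<^sup>L M (G n) - (LINT x|M. min (G n x) (G' x))) \<longlonglongrightarrow> 0"
      using z by simp
    show "\<forall>\<^sub>F n in sequentially. 0 \<le> integral\<^sup>L M (g n) - (LINT x|M. min (g n x) (G' x))"
      by (intro always_eventually allI) (simp add: integral_mono gi i1)
    show "\<forall>\<^sub>F n in sequentially. integral\<^sup>L M (g n) - (LINT x|M. min (g n x) (G' x))
       \<le> integral\<^sup>L M (G n) - (LINT x|M. min (G n x) (G' x))"
    proof (intro always_eventually allI)
      fix n
      \<comment> \<open>The excess \<open>x - min x c\<close> over a level \<open>c\<close>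
        increases with \<open>x\<close>. Hence the excess of \<open>g n\<close> over
        \<open>G'\<close> is at most that of \<open>G n\<close>, whose integral tends to 0.\<close>
      have "(LINT x|M. g n x - min (g n x) (G' x)) \<le> (LINT x|M. G n x - min (G n x) (G' x))"
      proof (rule integral_mono_AE)
        show "AE x in M. g n x - min (g n x) (G' x) \<le> G n x - min (G n x) (G' x)"
          using bd(2)[of n] by eventually_elim (simp add: min_def)
      qed (intro Bochner_Integration.integrable_diff gi i1 i2 Gi)+
      then show "integral\<^sup>L M (g n) - (LINT x|M. min (g n x) (G' x))
       \<le> integral\<^sup>L M (G n) - (LINT x|M. min (G n x) (G' x))"
        by (simp add: gi i1 i2 Gi)
    qed
  qed
  from tendsto_add[OF this D1] show "(\<lambda>n. integral\<^sup>L M (g n)) \<longlonglongrightarrow> integral\<^sup>L M g'" by simp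
qed

text \<open>The domination may fail on sets \<open>E n\<close> that vary with \<open>n\<close>,
  because the singularities of the shifted function move; only the limits need a fixed set
  \<open>E'\<close>.\<close>

lemma circ_mean_tendsto:
  assumes r: "r \<noteq> 0"
    and gm: "\<And>n. g n \<in> borel_measurable borel" "g' \<in> borel_measurable borel"
    and Gi: "\<And>n. circ_integrable r (G n)" "circ_integrable r G'"
    and fin: "\<And>n. finite (E n)" "finite E'"
    and nonneg: "\<And>n z. 0 \<le> g n z"
    and bd: "\<And>n z. norm z = \<bar>r\<bar> \<Longrightarrow> z \<notin> E n \<Longrightarrow> g n z \<le> G n z"
    and lim: "\<And>z. norm z = \<bar>r\<bar> \<Longrightarrow> z \<notin> E' \<Longrightarrow> (\<lambda>n. g n z) \<longlonglongrightarrow> g' z"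
      "\<And>z. norm z = \<bar>r\<bar> \<Longrightarrow> z \<notin> E' \<Longrightarrow> (\<lambda>n. G n z) \<longlonglongrightarrow> G' z"
    and int: "(\<lambda>n. circ_mean r (G n)) \<longlonglongrightarrow> circ_mean r G'"
  shows "circ_integrable r g'" "(\<lambda>n. circ_mean r (g n)) \<longlonglongrightarrow> circ_mean r g'"
proof -
  let ?M = "lebesgue_on {0..2*pi}" and ?e = "\<lambda>t. of_real r * cis t"
  have AE: "AE t in ?M. ?e t \<notin> E n" "AE t in ?M. ?e t \<notin> E'" for n
    using AE_circ_not_in_finite[OF r] fin by auto
  have "(\<lambda>n. 2*pi * circ_mean r (G n)) \<longlonglongrightarrow> 2*pi * circ_mean r G'"
    by (intro tendsto_intros int)
  then have int': "(\<lambda>n. LINT t|?M. G n (?e t)) \<longlonglongrightarrow> (LINT t|?M. G' (?e t))"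
    by (simp add: circ_mean_def)
  have 1: "AE t in ?M. g n (?e t) \<le> G n (?e t)" for n
    using AE(1)[of n] by eventually_elim (intro bd, auto simp: norm_mult)
  have 2: "AE t in ?M. (\<lambda>n. g n (?e t)) \<longlonglongrightarrow> g' (?e t)"
    using AE(2) by eventually_elim (intro lim, auto simp: norm_mult)
  have 3: "AE t in ?M. (\<lambda>n. G n (?e t)) \<longlonglongrightarrow> G' (?e t)"
    using AE(2) by eventually_elim (intro lim, auto simp: norm_mult)
  note C = generalized_dominated_convergence[OF measurable_circ[OF gm(1)] measurable_circ[OF gm(2)]
      Gi(1)[unfolded circ_integrable_def] Gi(2)[unfolded circ_integrable_def] AE_I2[OF nonneg] 1 2 3 int']
  show "circ_integrable r g'" using C(1) by (simp add: circ_integrable_def)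
  show "(\<lambda>n. circ_mean r (g n)) \<longlonglongrightarrow> circ_mean r g'"
    unfolding circ_mean_def by (intro tendsto_intros C(2))
qed

text \<open>Lipschitz bounds for numerator and denominator of \<open>f\<close> compensate the factor
  1/eta uniformly as eta tends to 0.\<close>

lemma holomorphic_Lipschitz:
  assumes h: "h holomorphic_on ball 0 K" and s: "s < K"
  obtains C :: real where "C > 0" "\<And>x y. x \<in> cball 0 s \<Longrightarrow> y \<in> cball 0 s \<Longrightarrow> norm (h x - h y) \<le> C * norm (x - y)"
    "\<And>x. x \<in> cball 0 s \<Longrightarrow> norm (h x) \<le> C"
proof -
  have sub: "cball 0 s \<subseteq> ball 0 K" using s by auto
  have "continuous_on (cball 0 s) (deriv h)" "continuous_on (cball 0 s) h"
    using h sub by (auto intro!: holomorphic_on_imp_continuous_on holomorphic_on_subset[OF holomorphic_deriv] intro: holomorphic_on_subset)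
  then have "bounded (deriv h ` cball 0 s)" "bounded (h ` cball 0 s)"
    by (auto intro!: compact_imp_bounded compact_continuous_image)
  then obtain B1 B2 where B: "B1 > 0" "\<And>x. x \<in> cball 0 s \<Longrightarrow> norm (deriv h x) \<le> B1" 
      "B2 > 0" "\<And>x. x \<in> cball 0 s \<Longrightarrow> norm (h x) \<le> B2"
    by (auto simp: bounded_pos)
  show ?thesis
  proof
    show "max B1 B2 > 0" using B by simp
    show "norm (h x) \<le> max B1 B2" if "x \<in> cball 0 s" for x using B(4)[OF that] by simp
    fix x y assume xy: "x \<in> cball (0::complex) s" "y \<in> cball (0::complex) s"
    have "norm (h x - h y) \<le> B1 * norm (x - y)"
    proof (rule field_differentiable_bound[OF convex_cball _ _ xy])
      fix z assume "z \<in> cball (0::complex) s"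
      then show "norm (deriv h z) \<le> B1" by (rule B(2))
      have "z \<in> ball 0 K" using sub \<open>z \<in> cball 0 s\<close> by blast
      then show "(h has_field_derivative deriv h z) (at z within cball 0 s)"
        by (rule has_field_derivative_at_within[OF holomorphic_derivI[OF h open_ball]])
    qed
    also have "\<dots> \<le> max B1 B2 * norm (x - y)" by (intro mult_right_mono) auto
    finally show "norm (h x - h y) \<le> max B1 B2 * norm (x - y)" .
  qed
qed

lemma ln_prod_power_norm:
  fixes z :: complex
  assumes "finite S" "\<And>a. a \<in> S \<Longrightarrow> z \<noteq> a"
  shows "ln (norm (\<Prod>a\<in>S. (z - a) ^ p a)) = (\<Sum>a\<in>S. real (p a) * ln (norm (z - a)))"
  using assms by (simp add: prod_norm[symmetric] norm_power) (subst ln_prod; auto simp: ln_realpow)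

context nonzero_meromorphic
begin

lemma log_deriv_eq:
  assumes u: "u holomorphic_on ball 0 K" and E: "finite E" "zp_set K \<subseteq> E"
    and f: "\<And>z. z \<in> ball 0 K - E \<Longrightarrow> f z = exp (u z) * (\<Prod>a\<in>zp_set K. (z - a) powi zorder f a)"
    and z: "z \<in> ball 0 K - E"
  shows "f z \<noteq> 0" "(f has_field_derivative deriv f z) (at z)"
    "deriv f z / f z = deriv u z + (\<Sum>a\<in>zp_set K. of_int (zorder f a) / (z - a))"
proof -
  let ?S = "zp_set K"
  let ?P = "\<lambda>z. \<Prod>a\<in>?S. (z - a) powi zorder f a"
  have nz: "z \<noteq> a" if "a \<in> ?S" for a using that z E by auto
  have Pnz: "?P z \<noteq> 0" using nz finite_zp_set by (auto simp: power_int_eq_0_iff)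
  then show fnz: "f z \<noteq> 0" using f[OF z] by simp
  have dP: "(?P has_field_derivative ?P z * (\<Sum>a\<in>?S. of_int (zorder f a) / (z - a))) (at z)"
  proof -
    have "((\<lambda>w. (w - a) powi zorder f a) has_field_derivative
        (z - a) powi zorder f a * (of_int (zorder f a) / (z - a))) (at z)" if "a \<in> ?S" for a
      using nz[OF that] by (auto intro!: derivative_eq_intros simp: power_int_diff)
    from has_field_derivative_prod[of ?S "\<lambda>a w. (w - a) powi zorder f a", OF this]
    have "(?P has_field_derivative (\<Sum>x\<in>?S. ((z - x) powi zorder f x * (of_int (zorder f x) / (z - x))) *
          (\<Prod>y\<in>?S - {x}. (z - y) powi zorder f y))) (at z)" by blast
    also have "(\<Sum>x\<in>?S. ((z - x) powi zorder f x * (of_int (zorder f x) / (z - x))) *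
          (\<Prod>y\<in>?S - {x}. (z - y) powi zorder f y)) = (\<Sum>x\<in>?S. ?P z * (of_int (zorder f x) / (z - x)))"
      by (intro sum.cong refl) (subst prod.remove[OF finite_zp_set], auto)
    finally show ?thesis by (simp add: sum_distrib_left)
  qed
  have du: "(u has_field_derivative deriv u z) (at z)"
    using z by (intro holomorphic_derivI[OF u]) auto
  have "((\<lambda>w. exp (u w) * ?P w) has_field_derivative
     (exp (u z) * ?P z * (deriv u z + (\<Sum>a\<in>?S. of_int (zorder f a) / (z - a))))) (at z)"
    by (rule derivative_eq_intros du dP refl)+ (simp add: algebra_simps)
  \<comment> \<open>Removing the finite set leaves an open set, so the factorization holds near
    \<open>z\<close> and its derivative passes to \<open>f\<close>.\<close>
  moreover have "open (ball 0 K - E)" using E by (intro open_Diff finite_imp_closed) auto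
  ultimately have "(f has_field_derivative
     (exp (u z) * ?P z * (deriv u z + (\<Sum>a\<in>?S. of_int (zorder f a) / (z - a))))) (at z)"
    using z f by (elim DERIV_cong_ev[THEN iffD2, rotated -1])
      (auto intro!: eventually_mono[OF eventually_nhds_in_open])
  then have d: "(f has_field_derivative (f z * (deriv u z + (\<Sum>a\<in>?S. of_int (zorder f a) / (z - a))))) (at z)"
    using f[OF z] by simp
  then have e: "deriv f z = f z * (deriv u z + (\<Sum>a\<in>?S. of_int (zorder f a) / (z - a)))"
    by (rule DERIV_imp_deriv)
  show "(f has_field_derivative deriv f z) (at z)" using d e by simp
  show "deriv f z / f z = deriv u z + (\<Sum>a\<in>?S. of_int (zorder f a) / (z - a))"
    using e fnz by simp
qed

text \<open>With \<open>f = A / Q\<close>, the numerator of the difference quotient is small of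
  order eta. What remains unbounded is \<open>1 / (P z * Q (z + eta))\<close>: zeros of
  \<open>f\<close> act at \<open>z\<close>, poles at the shifted point.\<close>

lemma proximity_diff_quotient_tendsto:
  assumes r: "r > 0"
  shows "circ_integrable r (\<lambda>z. log_plus (norm (deriv f z / f z)))"
    and "((\<lambda>\<eta>::complex. proximity r (\<lambda>z. 1 / \<eta> * (f (z + \<eta>) / f z - 1)))
           \<longlongrightarrow> circ_mean r (\<lambda>z. log_plus (norm (deriv f z / f z)))) (at 0)"
proof -
  \<comment> \<open>Shifts with \<open>|eta| < 1\<close> keep the circle in the closed disc of
    radius \<open>r + 1\<close>, compactly inside the ball of radius \<open>K\<close>.\<close>
  define K where "K = r + 2"
  have K: "K > 0" using r by (simp add: K_def)
  obtain u E where u: "u holomorphic_on ball 0 K" and E: "finite E" "zp_set K \<subseteq> E"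
    and f: "\<And>z. z \<in> ball 0 K - E \<Longrightarrow> f z = exp (u z) * (\<Prod>a\<in>zp_set K. (z - a) powi zorder f a)"
    using factorization[OF K] by blast
  let ?S = "zp_set K"
  define p where "p = (\<lambda>a. nat (zorder f a))"
  define q where "q = (\<lambda>a. nat (- zorder f a))"
  define P where "P = (\<lambda>z. \<Prod>a\<in>?S. (z - a) ^ p a)"
  define Q where "Q = (\<lambda>z. \<Prod>a\<in>?S. (z - a) ^ q a)"
  define A where "A = (\<lambda>z. exp (u z) * P z)"
  have nz: "z \<noteq> a" if "z \<notin> E" "a \<in> ?S" for z a using that E by auto
  have PQnz: "P z \<noteq> 0" "Q z \<noteq> 0" "A z \<noteq> 0" if "z \<notin> E" for z
    using nz[OF that] finite_zp_set by (auto simp: P_def Q_def A_def)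
  have fAQ: "f z = A z / Q z" if z: "z \<in> ball 0 K - E" for z
  proof -
    have "(z - a) powi zorder f a = (z - a) ^ p a / (z - a) ^ q a" if "a \<in> ?S" for a
      using nz[of z a] z that by (cases "zorder f a \<ge> 0") (auto simp: p_def q_def power_int_def divide_inverse power_inverse)
    then have "(\<Prod>a\<in>?S. (z - a) powi zorder f a) = P z / Q z"
      unfolding P_def Q_def prod_dividef[symmetric] by (intro prod.cong) auto
    then show ?thesis using f[OF z] by (simp add: A_def)
  qed
  have Phol: "P holomorphic_on ball 0 K" and Qhol: "Q holomorphic_on ball 0 K"
    unfolding P_def Q_def by (intro holomorphic_intros)+
  then have Ahol: "A holomorphic_on ball 0 K"
    unfolding A_def by (intro holomorphic_intros u)
  have ehol: "(\<lambda>z. exp (- u z)) holomorphic_on ball 0 K"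
    by (intro holomorphic_intros u)
  have sK: "r + 1 < K" by (simp add: K_def)
  obtain CA where CA: "CA > 0" "\<And>x y. x \<in> cball 0 (r+1) \<Longrightarrow> y \<in> cball 0 (r+1) \<Longrightarrow> norm (A x - A y) \<le> CA * norm (x - y)"
    "\<And>x. x \<in> cball 0 (r+1) \<Longrightarrow> norm (A x) \<le> CA"
    by (rule holomorphic_Lipschitz[OF Ahol sK]) blast
  obtain CQ where CQ: "CQ > 0" "\<And>x y. x \<in> cball 0 (r+1) \<Longrightarrow> y \<in> cball 0 (r+1) \<Longrightarrow> norm (Q x - Q y) \<le> CQ * norm (x - y)"
    "\<And>x. x \<in> cball 0 (r+1) \<Longrightarrow> norm (Q x) \<le> CQ"
    by (rule holomorphic_Lipschitz[OF Qhol sK]) blast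
  obtain Cu where Cu: "Cu > 0" "\<And>x. x \<in> cball 0 (r+1) \<Longrightarrow> norm (exp (- u x)) \<le> Cu"
    by (rule holomorphic_Lipschitz[OF ehol sK]) blast
  \<comment> \<open>The two terms of the numerator give \<open>2 * CA * CQ\<close>;
    \<open>Cu\<close> bounds the factor \<open>exp (- u z)\<close> in
    \<open>1 / A z\<close>.\<close>
  define D where "D = 2 * CA * CQ * Cu"
  have D: "D > 0" using CA CQ Cu by (simp add: D_def)
  define F where "F = (\<lambda>\<eta> z. 1 / \<eta> * (f (z + \<eta>) / f z - 1))"
  have Fbound: "norm (F \<eta> z) \<le> D / (norm (P z) * norm (Q (z + \<eta>)))"
    if "\<eta> \<noteq> 0" and z: "z \<in> cball 0 (r+1)" "z \<notin> E" and w: "z + \<eta> \<in> cball 0 (r+1)" "z + \<eta> \<notin> E" for \<eta> z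
  proof -
    let ?w = "z + \<eta>"
    have zK: "z \<in> ball 0 K - E" "?w \<in> ball 0 K - E" using z w sK by auto
    note N = PQnz[OF z(2)] PQnz[OF w(2)]
    have "F \<eta> z = ((A ?w - A z) * Q z - A z * (Q ?w - Q z)) / (\<eta> * A z * Q ?w)"
      unfolding F_def fAQ[OF zK(1)] fAQ[OF zK(2)] using N \<open>\<eta> \<noteq> 0\<close> by (simp add: field_simps)
    then have "norm (F \<eta> z) = norm ((A ?w - A z) * Q z - A z * (Q ?w - Q z)) / (norm \<eta> * norm (A z) * norm (Q ?w))"
      by (simp add: norm_divide norm_mult)
    also have "norm ((A ?w - A z) * Q z - A z * (Q ?w - Q z)) \<le> norm (A ?w - A z) * norm (Q z) + norm (A z) * norm (Q ?w - Q z)"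
      by (metis norm_mult norm_triangle_ineq4)
    also have "\<dots> \<le> (CA * norm \<eta>) * CQ + CA * (CQ * norm \<eta>)"
      using CA(2)[OF w(1) z(1)] CQ(2)[OF w(1) z(1)] CA(3)[OF z(1)] CQ(3)[OF z(1)] CA(1) CQ(1)
      by (intro add_mono mult_mono) auto
    finally have "norm (F \<eta> z) \<le> ((CA * norm \<eta>) * CQ + CA * (CQ * norm \<eta>)) / (norm \<eta> * norm (A z) * norm (Q ?w))"
      by (simp add: divide_right_mono)
    also have "\<dots> = (2 * CA * CQ * norm (exp (- u z))) / (norm (P z) * norm (Q ?w))"
      using N \<open>\<eta> \<noteq> 0\<close> by (simp add: A_def norm_mult exp_minus norm_inverse norm_divide field_simps)
    also have "\<dots> \<le> D / (norm (P z) * norm (Q ?w))"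
      unfolding D_def using CA CQ Cu(2)[OF z(1)] by (intro divide_right_mono mult_left_mono) auto
    finally show ?thesis .
  qed
  \<comment> \<open>Since \<open>|v - a| <= (r + 1) + K <= 2 * K\<close>, every difference
    \<open>La - ln |v - a|\<close> is nonnegative.\<close>
  define La where "La = ln (2 * K)"
  \<comment> \<open>The shift is put into the centre \<open>a - eta\<close>, so that the mean of
    each term is given by Jensen's formula.\<close>
  define G where "G = (\<lambda>\<eta> z. \<bar>ln D\<bar> + (\<Sum>a\<in>?S. real (p a) * (La - ln (norm (z - a))))
     + (\<Sum>a\<in>?S. real (q a) * (La - ln (norm (z - (a - \<eta>))))))"
  have Fle: "log_plus (norm (F \<eta> z)) \<le> G \<eta> z"
    if "\<eta> \<noteq> 0" and z: "z \<in> cball 0 (r+1)" "z \<notin> E" and w: "z + \<eta> \<in> cball 0 (r+1)" "z + \<eta> \<notin> E" for \<eta> z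
  proof -
    have *: "La - ln (norm (v - a)) \<ge> 0" if "v \<in> cball 0 (r+1)" "v \<notin> E" "a \<in> ?S" for v a
    proof -
      have "norm (v - a) > 0" using nz[OF that(2,3)] by simp
      moreover have "norm (v - a) \<le> 2 * K"
        using norm_triangle_ineq4[of v a] that by (auto simp: zp_set_def K_def)
      ultimately have "ln (norm (v - a)) \<le> ln (2 * K)" by (intro ln_mono) auto
      then show ?thesis by (simp add: La_def)
    qed
    have 1: "0 \<le> real (p a) * (La - ln (norm (z - a)))" if "a \<in> ?S" for a
      by (intro mult_nonneg_nonneg *[OF z that]) auto
    have 2: "0 \<le> real (q a) * (La - ln (norm (z + \<eta> - a)))" if "a \<in> ?S" for a
      by (intro mult_nonneg_nonneg *[OF w that]) auto
    have G_alt: "G \<eta> z = \<bar>ln D\<bar> + (\<Sum>a\<in>?S. real (p a) * (La - ln (norm (z - a))))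
      + (\<Sum>a\<in>?S. real (q a) * (La - ln (norm (z + \<eta> - a))))"
      by (simp add: G_def algebra_simps)
    have G0: "0 \<le> G \<eta> z"
      unfolding G_alt using 1 2 by (intro add_nonneg_nonneg sum_nonneg) auto
    have La0: "La \<ge> 0" using r by (simp add: La_def K_def)
    show ?thesis
    proof (cases "F \<eta> z = 0")
      case True
      then show ?thesis using G0 by (simp add: log_plus_def)
    next
      case False
      have pos: "norm (P z) > 0" "norm (Q (z + \<eta>)) > 0"
        using PQnz[OF z(2)] PQnz[OF w(2)] by auto
      have "ln (norm (F \<eta> z)) \<le> ln (D / (norm (P z) * norm (Q (z + \<eta>))))"
        using Fbound[OF that] False by (subst ln_le_cancel_iff) (use D pos in auto)
      also have "\<dots> = ln D - (ln (norm (P z)) + ln (norm (Q (z + \<eta>))))"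
        using D pos by (simp add: ln_div ln_mult)
      also have "ln (norm (P z)) = (\<Sum>a\<in>?S. real (p a) * ln (norm (z - a)))"
        unfolding P_def using nz[OF z(2)] finite_zp_set by (intro ln_prod_power_norm) auto
      also have "ln (norm (Q (z + \<eta>))) = (\<Sum>a\<in>?S. real (q a) * ln (norm (z + \<eta> - a)))"
        unfolding Q_def using nz[OF w(2)] finite_zp_set by (intro ln_prod_power_norm) auto
      also have "ln D - ((\<Sum>a\<in>?S. real (p a) * ln (norm (z - a))) + (\<Sum>a\<in>?S. real (q a) * ln (norm (z + \<eta> - a)))) \<le> G \<eta> z"
      proof -
        have "(\<Sum>a\<in>?S. - (real (p a) * ln (norm (z - a)))) \<le> (\<Sum>a\<in>?S. real (p a) * (La - ln (norm (z - a))))"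
          using La0 by (intro sum_mono) (simp add: algebra_simps)
        moreover have "(\<Sum>a\<in>?S. - (real (q a) * ln (norm (z + \<eta> - a)))) \<le> (\<Sum>a\<in>?S. real (q a) * (La - ln (norm (z + \<eta> - a))))"
          using La0 by (intro sum_mono) (simp add: algebra_simps)
        ultimately show ?thesis
          unfolding G_alt sum_negf by linarith
      qed
      finally show ?thesis using G0 by (simp add: log_plus_eq_max)
    qed
  qed
  have Gi: "circ_integrable r (G \<eta>)" for \<eta>
    unfolding G_def
    by (intro circ_integrable_add circ_integrable_const circ_integrable_sum circ_integrable_cmult circ_integrable_diff
        circ_mean_ln_norm_diff r)
  \<comment> \<open>Only \<open>ln (max r |a - eta|)\<close> depends on eta. It is continuous
    because \<open>r > 0\<close>, even when the singularity crosses the circle.\<close>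
  have Gm: "circ_mean r (G \<eta>) = \<bar>ln D\<bar> + (\<Sum>a\<in>?S. real (p a) * (La - ln (max r (norm a))))
     + (\<Sum>a\<in>?S. real (q a) * (La - ln (max r (norm (a - \<eta>)))))" for \<eta>
    unfolding G_def
    by (simp add: circ_mean_add circ_mean_sum circ_mean_cmult circ_mean_diff circ_integrable_add circ_integrable_sum circ_integrable_cmult circ_integrable_diff
        circ_mean_ln_norm_diff r)
  have shift: "(\<lambda>z. f (z + \<eta>)) \<in> borel_measurable borel" for \<eta>
    using measurable_compose[OF _ borel_measurable_f, of "\<lambda>z. z + \<eta>" borel] by simp
  have Fmeas: "(\<lambda>z. log_plus (norm (F \<eta> z))) \<in> borel_measurable borel" for \<eta>
    unfolding F_def using shift[of \<eta>] borel_measurable_f by measurable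
  have "deriv f meromorphic_on UNIV" by (intro meromorphic_intros mero)
  then have "deriv f \<in> borel_measurable borel" by (rule meromorphic_imp_borel_measurable)
  then have dmeas: "(\<lambda>z. log_plus (norm (deriv f z / f z))) \<in> borel_measurable borel"
    using borel_measurable_f by measurable
  define X where "X = (\<lambda>\<eta>. E \<union> (\<lambda>e. e - \<eta>) ` E)"
  have Xfin: "finite (X \<eta>)" for \<eta> using E by (simp add: X_def)
  have Fle': "log_plus (norm (F \<eta> z)) \<le> G \<eta> z" if "\<eta> \<in> ball 0 1 - {0}" "norm z = \<bar>r\<bar>" "z \<notin> X \<eta>" for \<eta> z
  proof (rule Fle)
    show "z + \<eta> \<notin> E" using that(3) by (force simp: X_def)
    show "z + \<eta> \<in> cball 0 (r+1)" using that r norm_triangle_ineq[of z \<eta>] by auto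
  qed (use that r in \<open>auto simp: X_def\<close>)
  have Fint: "circ_integrable r (\<lambda>z. log_plus (norm (F \<eta> z)))" if "\<eta> \<in> ball 0 1 - {0}" for \<eta>
    by (rule circ_integrable_bound[OF _ Fmeas Gi[of \<eta>] Xfin[of \<eta>]])
       (use r Fle'[OF that] log_plus_nonneg in \<open>auto simp: abs_of_nonneg\<close>)
  have main: "circ_integrable r (\<lambda>z. log_plus (norm (deriv f z / f z)))"
     "(\<lambda>n. circ_mean r (\<lambda>z. log_plus (norm (F (h n) z)))) \<longlonglongrightarrow> circ_mean r (\<lambda>z. log_plus (norm (deriv f z / f z)))"
    if h: "\<And>n. h n \<in> ball 0 1 - {0}" "h \<longlonglongrightarrow> 0" for h :: "nat \<Rightarrow> complex"
  proof -
    have lim1: "(\<lambda>n. log_plus (norm (F (h n) z))) \<longlonglongrightarrow> log_plus (norm (deriv f z / f z))"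
      if z: "norm z = \<bar>r\<bar>" "z \<notin> E" for z
    proof -
      have zK: "z \<in> ball 0 K - E" using z r by (simp add: K_def)
      note ld = log_deriv_eq(1,2)[OF u E f zK]
      have at0: "filterlim h (at 0) sequentially"
        using h by (intro filterlim_atI) auto
      have "((\<lambda>\<eta>. (f (z + \<eta>) - f z) / \<eta>) \<longlongrightarrow> deriv f z) (at 0)"
        using ld(2) by (simp add: DERIV_def)
      then have "(\<lambda>n. (f (z + h n) - f z) / h n) \<longlonglongrightarrow> deriv f z"
        using at0 by (rule filterlim_compose)
      then have "(\<lambda>n. (f (z + h n) - f z) / h n / f z) \<longlonglongrightarrow> deriv f z / f z"
        using ld(1) by (intro tendsto_intros)
      then have "(\<lambda>n. F (h n) z) \<longlonglongrightarrow> deriv f z / f z"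
        using ld(1) h(1) by (simp add: F_def field_simps)
      then show ?thesis by (intro tendsto_log_plus tendsto_norm)
    qed
    have lim2: "(\<lambda>n. G (h n) z) \<longlonglongrightarrow> G 0 z" if z: "norm z = \<bar>r\<bar>" "z \<notin> E" for z
      unfolding G_def by (intro tendsto_intros h(2)) (use nz[OF z(2)] in auto)
    have lim3: "(\<lambda>n. circ_mean r (G (h n))) \<longlonglongrightarrow> circ_mean r (G 0)"
      unfolding Gm by (intro tendsto_intros h(2)) (use r in auto)
    have r0: "r \<noteq> 0" using r by simp
    note C = circ_mean_tendsto[where g = "\<lambda>n z. log_plus (norm (F (h n) z))" and G = "\<lambda>n. G (h n)" and E = "\<lambda>n. X (h n)",
       OF r0 Fmeas dmeas Gi Gi Xfin E(1) log_plus_nonneg Fle'[OF h(1)] lim1 lim2 lim3]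
    show "circ_integrable r (\<lambda>z. log_plus (norm (deriv f z / f z)))" by (rule C(1))
    show "(\<lambda>n. circ_mean r (\<lambda>z. log_plus (norm (F (h n) z)))) \<longlonglongrightarrow> circ_mean r (\<lambda>z. log_plus (norm (deriv f z / f z)))"
      by (rule C(2))
  qed
  \<comment> \<open>One admissible sequence is enough for the integrability of the limit; the 2
    keeps it in the open unit ball.\<close>
  define h where "h = (\<lambda>n::nat. complex_of_real (1 / (real n + 2)))"
  have "(\<lambda>n. 1 / (real n + 2)) \<longlonglongrightarrow> 0" by real_asymp
  then have "h \<longlonglongrightarrow> of_real 0"
    unfolding h_def by (rule tendsto_of_real)
  then have "h \<longlonglongrightarrow> 0" by simp
  moreover have "h n \<in> ball 0 1 - {0}" for n
    unfolding h_def by (simp add: norm_of_real del: of_real_divide of_real_add)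
  ultimately show "circ_integrable r (\<lambda>z. log_plus (norm (deriv f z / f z)))"
    using main(1)[of h] by blast
  have "((\<lambda>\<eta>. circ_mean r (\<lambda>z. log_plus (norm (F \<eta> z)))) \<longlongrightarrow> circ_mean r (\<lambda>z. log_plus (norm (deriv f z / f z)))) (at 0 within ball 0 1)"
    unfolding tendsto_at_iff_sequentially o_def using main(2) by blast
  moreover have "at (0::complex) within ball 0 1 = at 0" by (rule at_within_open) auto
  moreover have "eventually (\<lambda>\<eta>. circ_mean r (\<lambda>z. log_plus (norm (F \<eta> z))) = proximity r (\<lambda>z. 1 / \<eta> * (f (z + \<eta>) / f z - 1))) (at 0)"
  proof -
    have "eventually (\<lambda>\<eta>::complex. \<eta> \<in> ball 0 1 - {0}) (at 0)"
      by (intro eventually_at_in_open) auto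
    then show ?thesis
      by eventually_elim (use proximity_conv_circ_mean[OF Fint] in \<open>simp add: F_def\<close>)
  qed
  ultimately show "((\<lambda>\<eta>::complex. proximity r (\<lambda>z. 1 / \<eta> * (f (z + \<eta>) / f z - 1)))
           \<longlongrightarrow> circ_mean r (\<lambda>z. log_plus (norm (deriv f z / f z)))) (at 0)"
    by (simp add: tendsto_cong)
qed

end

section \<open>Growth of the logarithmic derivative\<close>

text \<open>A number in [0,1] is at most its \<open>al\<close>-th power; this is applied to
  \<open>x / (x + y)\<close> and \<open>y / (x + y)\<close>.\<close>

lemma powr_add_le:
  fixes x y :: real
  assumes "0 \<le> x" "0 \<le> y" "0 < al" "al \<le> 1"
  shows "(x + y) powr al \<le> x powr al + y powr al"
proof (cases "x + y = 0")
  case False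
  then have s: "x + y > 0" using assms by simp
  have *: "t * (x + y) powr al / (x + y) \<le> t powr al" if "0 \<le> t" "t \<le> x + y" for t
  proof (cases "t = 0")
    case False
    then have "(t / (x + y)) powr 1 \<le> (t / (x + y)) powr al"
      using that assms s by (intro powr_mono') auto
    then have "t / (x + y) * (x + y) powr al \<le> t powr al / (x + y) powr al * (x + y) powr al"
      using that s False by (intro mult_right_mono) (auto simp: powr_divide)
    then show ?thesis using s by simp
  qed auto
  have "(x + y) powr al = x * (x + y) powr al / (x + y) + y * (x + y) powr al / (x + y)"
    using s by (simp add: add_divide_distrib[symmetric] distrib_right[symmetric])
  also have "\<dots> \<le> x powr al + y powr al"
    by (intro add_mono *) (use assms in auto)
  finally show ?thesis .
qed (use assms in auto)

lemma powr_sum_le: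
  fixes g :: "'a \<Rightarrow> real"
  assumes "finite S" "\<And>a. a \<in> S \<Longrightarrow> 0 \<le> g a" "0 < al" "al \<le> 1"
  shows "(\<Sum>a\<in>S. g a) powr al \<le> (\<Sum>a\<in>S. g a powr al)"
  using assms
proof (induction S rule: finite_induct)
  case (insert b S)
  have "(g b + (\<Sum>a\<in>S. g a)) powr al \<le> g b powr al + (\<Sum>a\<in>S. g a) powr al"
    using insert.prems by (intro powr_add_le sum_nonneg) auto
  then show ?case using insert by simp
qed auto

text \<open>For \<open>x >= 1\<close>, \<open>ln x\<close> is \<open>1 / al\<close> times the
  logarithm of \<open>x powr al\<close>; adding 1 covers small \<open>x\<close> as well.\<close>

lemma log_plus_le_ln_powr:
  assumes "0 \<le> x" "0 < al"
  shows "log_plus x \<le> (1 / al) * ln (1 + x powr al)"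
proof (cases "x \<ge> 1")
  case True
  have "ln x = (1 / al) * ln (x powr al)" using assms True by (simp add: ln_powr)
  also have "\<dots> \<le> (1 / al) * ln (1 + x powr al)"
    using assms True by (intro mult_left_mono ln_mono) auto
  finally show ?thesis using True by (simp add: log_plus_def)
next
  case False
  then show ?thesis using assms by (simp add: log_plus_def)
qed

text \<open>Integrating this tangent line takes the place of Jensen's inequality for the concave
  logarithm: only the mean of \<open>x\<close> has to be known.\<close>

lemma ln_le_tangent:
  fixes x c :: real
  assumes "x > 0" "c > 0"
  shows "ln x \<le> ln c + x / c - 1"
  using ln_le_minus_one[of "x / c"] assms by (simp add: ln_div)

section \<open>Zeros, poles and the circle mean of \<open>f'/f\<close> in terms of the
  characteristic\<close>

context nonzero_meromorphic
begin

definition zp_count :: "real \<Rightarrow> real" where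
  "zp_count R = (\<Sum>a\<in>zp_set R. \<bar>real_of_int (zorder f a)\<bar>)"

lemma zp_count_nonneg: "zp_count R \<ge> 0"
  unfolding zp_count_def by (intro sum_nonneg) auto

text \<open>The threshold 1 comes from the weight \<open>ln R\<close> of the origin.\<close>

lemma jweight_nonneg: "R \<ge> 1 \<Longrightarrow> jweight R a \<ge> 0"
  by (auto simp: jweight_def)

lemma proximity_f:
  assumes "R > 0"
  shows "circ_integrable R (\<lambda>z. log_plus (norm (f z)))"
    "proximity R f = circ_mean R (\<lambda>z. log_plus (norm (f z)))"
    "circ_integrable R (\<lambda>z. ln (norm (f z)))"
proof -
  obtain u E where "u holomorphic_on ball 0 (R + 1)" "finite E" "zp_set (R + 1) \<subseteq> E"
    "\<And>z. z \<in> ball 0 (R + 1) - E \<Longrightarrow> f z = exp (u z) * (\<Prod>a\<in>zp_set (R + 1). (z - a) powi zorder f a)"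
    using factorization[of "R + 1"] assms by auto
  from jensen(2)[OF assms _ this] show i: "circ_integrable R (\<lambda>z. ln (norm (f z)))" by simp
  have "circ_integrable R (\<lambda>z. max 0 (ln (norm (f z))))"
    by (intro circ_integrable_max circ_integrable_const i)
  then show "circ_integrable R (\<lambda>z. log_plus (norm (f z)))"
    by (simp add: log_plus_eq_max)
  then show "proximity R f = circ_mean R (\<lambda>z. log_plus (norm (f z)))"
    by (rule proximity_conv_circ_mean)
qed

text \<open>Let \<open>M\<close> be the proximity, \<open>N\<close> and \<open>Z\<close> the
  weighted pole and zero sums. Then \<open>T = M + N\<close>, and Jensen's formula bounds
  \<open>Z\<close> by \<open>T\<close> minus the constant, which is half of the first fundamental
  theorem. For the second claim \<open>|ln x|\<close> is written as
  \<open>2 * log_plus x - ln x\<close>.\<close>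

lemma nevanlinna_char_bounds:
  assumes R: "R \<ge> 1" "R < K"
  shows "(\<Sum>a\<in>zp_set K. \<bar>real_of_int (zorder f a)\<bar> * jweight R a) \<le> 2 * nevanlinna_char R f + \<bar>jensen_const\<bar>"
    and "circ_mean R (\<lambda>z. \<bar>ln (norm (f z))\<bar>) \<le> 2 * nevanlinna_char R f + \<bar>jensen_const\<bar>"
proof -
  let ?S = "zp_set K"
  define Z where "Z = (\<Sum>a\<in>?S. max 0 (real_of_int (zorder f a)) * jweight R a)"
  define N where "N = (\<Sum>a\<in>?S. max 0 (- real_of_int (zorder f a)) * jweight R a)"
  define M where "M = circ_mean R (\<lambda>z. log_plus (norm (f z)))"
  have R0: "R > 0" using R by simp
  have "K > 0" using R by simp
  then obtain u E where u: "u holomorphic_on ball 0 K" "finite E" "zp_set K \<subseteq> E"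
    "\<And>z. z \<in> ball 0 K - E \<Longrightarrow> f z = exp (u z) * (\<Prod>a\<in>zp_set K. (z - a) powi zorder f a)"
    using factorization by blast
  have Z0: "Z \<ge> 0" and N0: "N \<ge> 0"
    unfolding Z_def N_def using jweight_nonneg[OF R(1)] by (auto intro!: sum_nonneg)
  have M0: "M \<ge> 0"
    unfolding M_def using circ_mean_mono[of R "\<lambda>_. 0" "\<lambda>z. log_plus (norm (f z))" "{}"] R0 proximity_f[OF R0] log_plus_nonneg by simp
  have "pole_counting R f = N"
    unfolding pole_counting_eq[OF R0 R(2)] N_def
    using finite_zp_set by (intro sum.mono_neutral_cong_left) (auto simp: max_def)
  then have T: "nevanlinna_char R f = M + N"
    unfolding nevanlinna_char_def M_def proximity_f(2)[OF R0] by simp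
  have "(\<Sum>a\<in>?S. zorder f a * jweight R a) = Z - N"
    unfolding Z_def N_def sum_subtractf[symmetric] by (intro sum.cong) (auto simp: max_def)
  then have J: "circ_mean R (\<lambda>z. ln (norm (f z))) = jensen_const + Z - N"
    using jensen(3)[OF R0 R(2) u] by simp
  have "circ_mean R (\<lambda>z. ln (norm (f z))) \<le> M"
    unfolding M_def by (rule circ_mean_mono[where E = "{}"]) (use R0 proximity_f[OF R0] in \<open>auto simp: log_plus_eq_max\<close>)
  then have Z: "Z \<le> M + N - jensen_const" using J by simp
  have "(\<Sum>a\<in>?S. \<bar>real_of_int (zorder f a)\<bar> * jweight R a) = Z + N"
    unfolding Z_def N_def sum.distrib[symmetric] by (intro sum.cong) (auto simp: max_def)
  then show "(\<Sum>a\<in>?S. \<bar>real_of_int (zorder f a)\<bar> * jweight R a) \<le> 2 * nevanlinna_char R f + \<bar>jensen_const\<bar>"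
    using T Z M0 by simp
  have "(\<lambda>z. \<bar>ln (norm (f z))\<bar>) = (\<lambda>z. 2 * log_plus (norm (f z)) - ln (norm (f z)))"
    by (auto simp: log_plus_eq_max max_def)
  then have "circ_mean R (\<lambda>z. \<bar>ln (norm (f z))\<bar>) = 2 * M - (jensen_const + Z - N)"
    using proximity_f[OF R0] by (simp add: circ_mean_diff circ_mean_cmult circ_integrable_cmult M_def J)
  then show "circ_mean R (\<lambda>z. \<bar>ln (norm (f z))\<bar>) \<le> 2 * nevanlinna_char R f + \<bar>jensen_const\<bar>"
    using T Z0 N0 by simp
qed

text \<open>On the circle of radius \<open>2 * R\<close> every counted point has weight at least
  \<open>ln 2\<close>: \<open>ln (2 * R / |a|)\<close> in general, \<open>ln (2 * R)\<close> at the
  origin.\<close>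

lemma zp_count_le:
  assumes R: "R \<ge> 1"
  shows "zp_count R \<le> (2 * nevanlinna_char (2 * R) f + \<bar>jensen_const\<bar>) / ln 2"
proof -
  have "zp_count R * ln 2 \<le> (\<Sum>a\<in>zp_set R. \<bar>real_of_int (zorder f a)\<bar> * jweight (2 * R) a)"
    unfolding zp_count_def sum_distrib_right
  proof (intro sum_mono mult_left_mono)
    fix a assume a: "a \<in> zp_set R"
    have "ln (norm a) + ln 2 \<le> ln (max (2 * R) (norm a))" if "a \<noteq> 0"
    proof -
      have "norm a \<le> R" using a by (simp add: zp_set_def)
      then have "norm a * 2 \<le> max (2 * R) (norm a)" by simp
      then have "ln (norm a * 2) \<le> ln (max (2 * R) (norm a))" using that by (intro ln_mono) auto
      then show ?thesis using that by (simp add: ln_mult)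
    qed
    then show "ln 2 \<le> jweight (2 * R) a"
      using R by (auto simp: jweight_def)
  qed auto
  also have "\<dots> \<le> (\<Sum>a\<in>zp_set (2 * R + 1). \<bar>real_of_int (zorder f a)\<bar> * jweight (2 * R) a)"
    using R finite_zp_set jweight_nonneg[of "2 * R"] by (intro sum_mono2) (auto simp: zp_set_def)
  also have "\<dots> \<le> 2 * nevanlinna_char (2 * R) f + \<bar>jensen_const\<bar>"
    using R by (intro nevanlinna_char_bounds) auto
  finally show ?thesis by (simp add: pos_le_divide_eq)
qed

text \<open>A bound for the mean of \<open>|Re u|\<close> on the circle of radius
  \<open>2 * r\<close>, where \<open>u\<close> belongs to the disc of radius \<open>3 * r\<close>;
  \<open>5 * r\<close> bounds the distance between their points.\<close>

definition log_deriv_bound :: "real \<Rightarrow> real" where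
  "log_deriv_bound r = 2 * nevanlinna_char (2 * r) f + \<bar>jensen_const\<bar> + zp_count (3 * r) * (2 * ln (5 * r))"

lemma log_deriv_proximity_le:
  assumes al: "0 < al" "al < 1"
    and C: "\<And>r a. r > 0 \<Longrightarrow> circ_integrable r (\<lambda>z. norm (z - a) powr (-al))"
     "\<And>r a. r > 0 \<Longrightarrow> circ_mean r (\<lambda>z. norm (z - a) powr (-al)) \<le> C * r powr (-al)" "C \<ge> 0"
    and r: "r \<ge> 1" and int: "circ_integrable r (\<lambda>z. log_plus (norm (deriv f z / f z)))"
  shows "circ_mean r (\<lambda>z. log_plus (norm (deriv f z / f z)))
    \<le> (1 / al) * ln (1 + ((4 / r * log_deriv_bound r) powr al + C * zp_count (3 * r) * r powr (-al)))"
proof -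
  define K where "K = 3 * r"
  define R where "R = 2 * r"
  let ?S = "zp_set K" and ?k = "\<lambda>a. \<bar>real_of_int (zorder f a)\<bar>"
  have K: "K > 0" "R > 0" "R < K" "R \<ge> 1" using r by (auto simp: K_def R_def)
  obtain u E where u: "u holomorphic_on ball 0 K" "finite E" "zp_set K \<subseteq> E"
    and f: "\<And>z. z \<in> ball 0 K - E \<Longrightarrow> f z = exp (u z) * (\<Prod>a\<in>zp_set K. (z - a) powi zorder f a)"
    using factorization[OF K(1)] by blast
  have uR: "u holomorphic_on cball 0 R"
    using u(1) by (rule holomorphic_on_subset) (use K in auto)
  have nz: "z \<noteq> a" if "z \<notin> E" "a \<in> ?S" for z a using that u by auto
  define La where "La = ln (5 * r)"
  have La0: "La \<ge> 0" using r by (simp add: La_def)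
  \<comment> \<open>From \<open>ln |z - a| <= La\<close> it follows that
    \<open>2 * La - ln |z - a|\<close> dominates the absolute value for either sign, and unlike the
    absolute value it has an explicit mean.\<close>
  let ?h = "\<lambda>z. \<bar>ln (norm (f z))\<bar> + (\<Sum>a\<in>?S. ?k a * (2 * La - ln (norm (z - a))))"
  have lni: "circ_integrable R (\<lambda>z. ln (norm (z - a)))" for a
    using circ_mean_ln_norm_diff[OF K(2)] by auto
  have hi: "circ_integrable R (\<lambda>z. \<bar>ln (norm (f z))\<bar>)"
     "circ_integrable R (\<lambda>z. ?k a * (2 * La - ln (norm (z - a))))"
     "circ_integrable R (\<lambda>z. \<Sum>a\<in>?S. ?k a * (2 * La - ln (norm (z - a))))" for a
    by (intro circ_integrable_add circ_integrable_abs proximity_f K circ_integrable_sum circ_integrable_cmult circ_integrable_diff circ_integrable_const lni)+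
  have "circ_mean R (\<lambda>z. \<bar>Re (u z)\<bar>) \<le> circ_mean R ?h"
  proof (rule circ_mean_mono[where E = E])
    fix z assume z: "norm z = \<bar>R\<bar>" "z \<notin> E"
    have "z \<in> ball 0 K - E" using z K by simp
    from jensen(1)[OF K(2,3) u f this]
    have "Re (u z) = ln (norm (f z)) - (\<Sum>a\<in>?S. zorder f a * ln (norm (z - a)))" by simp
    also have "\<bar>\<dots>\<bar> \<le> \<bar>ln (norm (f z))\<bar> + \<bar>\<Sum>a\<in>?S. zorder f a * ln (norm (z - a))\<bar>"
      by (rule abs_triangle_ineq4)
    also have "\<bar>\<Sum>a\<in>?S. zorder f a * ln (norm (z - a))\<bar> \<le> (\<Sum>a\<in>?S. \<bar>zorder f a * ln (norm (z - a))\<bar>)"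
      by (rule sum_abs)
    also have "\<dots> \<le> (\<Sum>a\<in>?S. ?k a * (2 * La - ln (norm (z - a))))"
    proof (rule sum_mono)
      fix a assume a: "a \<in> ?S"
      have "norm (z - a) > 0" using nz[OF z(2) a] by simp
      moreover have "norm (z - a) \<le> 5 * r"
        using norm_triangle_ineq4[of z a] z a r by (auto simp: zp_set_def K_def R_def)
      ultimately have "ln (norm (z - a)) \<le> La" unfolding La_def by (intro ln_mono) auto
      then have "\<bar>ln (norm (z - a))\<bar> \<le> 2 * La - ln (norm (z - a))" using La0 by auto
      then show "\<bar>zorder f a * ln (norm (z - a))\<bar> \<le> ?k a * (2 * La - ln (norm (z - a)))"
        unfolding abs_mult by (intro mult_left_mono) auto
    qed
    finally show "\<bar>Re (u z)\<bar> \<le> ?h z" by simp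
  qed (use K u(2) hi in \<open>auto intro!: circ_integrable_add circ_integrable_abs circ_mean_Re_holomorphic uR\<close>)
  also have "\<dots> = circ_mean R (\<lambda>z. \<bar>ln (norm (f z))\<bar>) + (\<Sum>a\<in>?S. ?k a * (2 * La - ln (max R (norm a))))"
    by (subst circ_mean_add[OF hi(1,3)], subst circ_mean_sum[OF hi(2)])
       (simp add: circ_mean_cmult circ_mean_diff circ_mean_ln_norm_diff[OF K(2)])
  \<comment> \<open>The terms \<open>- ln (max R |a|)\<close> are at most 0 because
    \<open>R >= 1\<close>, and are dropped.\<close>
  also have "\<dots> \<le> (2 * nevanlinna_char R f + \<bar>jensen_const\<bar>) + (\<Sum>a\<in>?S. ?k a * (2 * La))"
    using K by (intro add_mono nevanlinna_char_bounds(2)[OF K(4,3)] sum_mono mult_left_mono) auto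
  also have "(\<Sum>a\<in>?S. ?k a * (2 * La)) = zp_count K * (2 * La)"
    by (simp add: zp_count_def sum_distrib_right)
  finally have Reu: "circ_mean R (\<lambda>z. \<bar>Re (u z)\<bar>) \<le> log_deriv_bound r"
    by (simp add: log_deriv_bound_def K_def R_def La_def)
  define D where "D = 4 / r * log_deriv_bound r"
  have dul: "norm (deriv u z) \<le> D" if "norm z = r" for z
  proof -
    have "norm (deriv u z) \<le> 2 * R / (R - norm z)\<^sup>2 * circ_mean R (\<lambda>w. \<bar>Re (u w)\<bar>)"
      by (rule norm_deriv_le_circ_mean_Re[OF uR]) (use that r in \<open>simp add: R_def\<close>)
    also have "2 * R / (R - norm z)\<^sup>2 = 4 / r"
      using that r by (simp add: R_def power2_eq_square)
    also have "4 / r * circ_mean R (\<lambda>w. \<bar>Re (u w)\<bar>) \<le> D"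
      unfolding D_def using r by (intro mult_left_mono Reu) auto
    finally show ?thesis .
  qed
  have D0: "D \<ge> 0"
    by (rule order_trans[OF norm_ge_zero dul[of "of_real r"]]) (use r in simp)
  let ?Y = "\<lambda>z. D powr al + (\<Sum>a\<in>?S. ?k a * norm (z - a) powr (-al))"
  define M where "M = D powr al + C * zp_count K * r powr (-al)"
  have M0: "M \<ge> 0" using C(3) zp_count_nonneg by (simp add: M_def)
  have r0: "r > 0" using r by simp
  have Yi: "circ_integrable r (\<lambda>z. ?k a * norm (z - a) powr (-al))"
      "circ_integrable r (\<lambda>z. \<Sum>a\<in>?S. ?k a * norm (z - a) powr (-al))" "circ_integrable r ?Y" for a
    by (intro circ_integrable_add circ_integrable_const circ_integrable_sum circ_integrable_cmult C r0)+
  have "circ_mean r ?Y = D powr al + (\<Sum>a\<in>?S. ?k a * circ_mean r (\<lambda>z. norm (z - a) powr (-al)))"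
    by (subst circ_mean_add[OF circ_integrable_const Yi(2)], subst circ_mean_sum[OF Yi(1)]) (simp add: circ_mean_cmult)
  also have "\<dots> \<le> D powr al + (\<Sum>a\<in>?S. ?k a * (C * r powr (-al)))"
    by (intro add_left_mono sum_mono mult_left_mono C r0) auto
  also have "\<dots> = M" by (simp add: M_def zp_count_def sum_distrib_right mult_ac sum_distrib_left)
  finally have YM: "circ_mean r ?Y \<le> M" .
  \<comment> \<open>This is the tangent to the logarithm at \<open>1 + M\<close>. Its mean is affine
    in the mean of \<open>?Y\<close>, and inserting the bound \<open>M\<close> leaves exactly
    \<open>ln (1 + M)\<close>.\<close>
  let ?g = "\<lambda>z. (1 / al) * (ln (1 + M) - 1 + 1 / (1 + M) * (1 + ?Y z))"
  have gi: "circ_integrable r ?g"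
    by (intro circ_integrable_cmult circ_integrable_add circ_integrable_const circ_integrable_sum C r0)
  have "circ_mean r (\<lambda>z. log_plus (norm (deriv f z / f z))) \<le> circ_mean r ?g"
  proof (rule circ_mean_mono[OF _ int gi u(2)])
    fix z assume z: "norm z = \<bar>r\<bar>" "z \<notin> E"
    have zK: "z \<in> ball 0 K - E" using z r by (simp add: K_def)
    have "norm (deriv f z / f z) = norm (deriv u z + (\<Sum>a\<in>?S. of_int (zorder f a) / (z - a)))"
      using log_deriv_eq(3)[OF u f zK] by simp
    also have "\<dots> \<le> norm (deriv u z) + (\<Sum>a\<in>?S. norm (of_int (zorder f a) / (z - a)))"
      by (intro norm_triangle_le add_left_mono norm_sum)
    also have "\<dots> \<le> D + (\<Sum>a\<in>?S. ?k a / norm (z - a))"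
      using dul[of z] z r by (simp add: norm_divide)
    finally have le: "norm (deriv f z / f z) \<le> D + (\<Sum>a\<in>?S. ?k a / norm (z - a))" .
    have "norm (deriv f z / f z) powr al \<le> (D + (\<Sum>a\<in>?S. ?k a / norm (z - a))) powr al"
      using al by (intro powr_mono2 le) auto
    also have "\<dots> \<le> D powr al + (\<Sum>a\<in>?S. ?k a / norm (z - a)) powr al"
      using al D0 by (intro powr_add_le sum_nonneg) auto
    also have "(\<Sum>a\<in>?S. ?k a / norm (z - a)) powr al \<le> (\<Sum>a\<in>?S. (?k a / norm (z - a)) powr al)"
      using al finite_zp_set by (intro powr_sum_le) auto
    also have "\<dots> \<le> (\<Sum>a\<in>?S. ?k a * norm (z - a) powr (-al))"
    proof (rule sum_mono)
      fix a assume a: "a \<in> ?S"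
      \<comment> \<open>Orders are nonzero integers on \<open>zp_set\<close>, so their
        \<open>al\<close>-th powers are at most the orders and multiplicities enter linearly, as in
        \<open>zp_count\<close>.\<close>
      have k1: "?k a \<ge> 1" using a by (auto simp: zp_set_def)
      then have "?k a powr al \<le> ?k a powr 1" using al by (intro powr_mono) auto
      then have "?k a powr al \<le> ?k a" using k1 by simp
      then show "(?k a / norm (z - a)) powr al \<le> ?k a * norm (z - a) powr (-al)"
        using nz[OF z(2) a] by (simp add: powr_divide powr_minus_divide divide_right_mono)
    qed
    finally have Y: "norm (deriv f z / f z) powr al \<le> ?Y z" by simp
    have Ypos: "?Y z \<ge> 0" using Y powr_ge_zero order_trans by blast
    have "log_plus (norm (deriv f z / f z)) \<le> (1 / al) * ln (1 + norm (deriv f z / f z) powr al)"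
      using al by (intro log_plus_le_ln_powr) auto
    also have "\<dots> \<le> (1 / al) * ln (1 + ?Y z)"
      using al Y by (intro mult_left_mono ln_mono) (auto simp: add_pos_nonneg)
    also have "\<dots> \<le> ?g z"
      using al ln_le_tangent[of "1 + ?Y z" "1 + M"] Ypos M0 by (intro mult_left_mono) auto
    finally show "log_plus (norm (deriv f z / f z)) \<le> ?g z" .
  qed (use r in auto)
  also have "circ_mean r ?g = (1 / al) * (ln (1 + M) - 1 + 1 / (1 + M) * (1 + circ_mean r ?Y))"
    unfolding circ_mean_cmult
    by (subst circ_mean_add, intro circ_integrable_const, intro circ_integrable_cmult circ_integrable_add circ_integrable_const Yi)
       (simp only: circ_mean_cmult circ_mean_const circ_mean_add[OF circ_integrable_const Yi(3)])
  also have "\<dots> \<le> (1 / al) * (ln (1 + M) - 1 + 1 / (1 + M) * (1 + M))"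
    using al YM M0 by (intro mult_left_mono add_left_mono divide_right_mono) auto
  also have "\<dots> = (1 / al) * ln (1 + M)" using M0 by simp
  finally show ?thesis by (simp add: M_def D_def K_def)
qed

section \<open>Growth of the limit in terms of the order\<close>

definition log_deriv_proximity :: "real \<Rightarrow> real" where
  "log_deriv_proximity r = circ_mean r (\<lambda>z. log_plus (norm (deriv f z / f z)))"

lemma log_deriv_proximity_nonneg: "r > 0 \<Longrightarrow> log_deriv_proximity r \<ge> 0"
  unfolding log_deriv_proximity_def
  using circ_mean_mono[of r "\<lambda>_. 0" "\<lambda>z. log_plus (norm (deriv f z / f z))" "{}"]
    proximity_diff_quotient_tendsto(1)[of r] log_plus_nonneg by simp

lemma eventually_char_le:
  assumes "nevanlinna_order f < ereal s"
  shows "eventually (\<lambda>r. nevanlinna_char r f \<le> r powr s) at_top"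
proof -
  have "eventually (\<lambda>r::real. ereal (log_plus (nevanlinna_char r f) / ln r) < ereal s) at_top"
    using assms unfolding nevanlinna_order_def by (rule Limsup_lessD)
  then show ?thesis
    using eventually_gt_at_top[of 1]
  proof eventually_elim
    case (elim r)
    then have "ln (max 1 (nevanlinna_char r f)) \<le> s * ln r"
      by (simp add: log_plus_def pos_divide_less_eq)
    then have "exp (ln (max 1 (nevanlinna_char r f))) \<le> exp (s * ln r)"
      by (simp only: exp_le_cancel_iff)
    moreover have "exp (ln (max 1 (nevanlinna_char r f))) = max 1 (nevanlinna_char r f)"
      by (rule exp_ln) simp
    ultimately show ?case using elim by (simp add: powr_def)
  qed
qed

text \<open>The two terms are the contributions of \<open>u'\<close> and of the partial fractions.
  With \<open>s >= 0\<close> one has \<open>r powr s >= 1\<close> for \<open>r >= 1\<close>, which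
  lets additive constants be absorbed.\<close>

lemma growth_bound:
  assumes ord: "nevanlinna_order f < ereal s" and s: "s \<ge> 0" and al: "0 < al" "al < 1"
  obtains c1 c2 where "c1 \<ge> 0" "c2 \<ge> 0" "eventually (\<lambda>r. log_deriv_proximity r
      \<le> (1 / al) * ln (1 + ((c1 * (r powr (s - 1) * (1 + ln (5 * r)))) powr al + c2 * r powr (s - al)))) at_top"
proof -
  obtain C where C: "C \<ge> 0" "\<And>r a. r > 0 \<Longrightarrow> circ_integrable r (\<lambda>z. norm (z - a) powr (-al))"
    "\<And>r a. r > 0 \<Longrightarrow> circ_mean r (\<lambda>z. norm (z - a) powr (-al)) \<le> C * r powr (-al)"
    using circ_powr_bound[OF al] by blast
  obtain r0 where r0: "\<And>r. r \<ge> r0 \<Longrightarrow> nevanlinna_char r f \<le> r powr s"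
    using eventually_char_le[OF ord] by (auto simp: eventually_at_top_linorder)
  \<comment> \<open>The characteristic is needed at \<open>2 * r\<close> and, for the count on the
    disc of radius \<open>3 * r\<close>, at \<open>6 * r\<close>; \<open>b\<close> serves for all
    radii in between.\<close>
  define b where "b = 2 * 6 powr s + \<bar>jensen_const\<bar>"
  define c where "c = b / ln 2"
  have b0: "b \<ge> 0" by (simp add: b_def)
  then have c0: "c \<ge> 0" by (simp add: c_def)
  define c1 where "c1 = 4 * (b + 2 * c)"
  have "log_deriv_proximity r \<le> (1 / al) * ln (1 + ((c1 * (r powr (s - 1) * (1 + ln (5 * r)))) powr al + (C * c) * r powr (s - al)))"
    if r: "r \<ge> max 1 r0" for r
  proof -
    have r1: "r \<ge> 1" "r > 0" using r by auto
    have one: "1 \<le> r powr s" using r1 s by (simp add: ge_one_powr_ge_zero)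
    have six: "(6 * r) powr s = 6 powr s * r powr s" using r1 by (simp add: powr_mult)
    have T: "2 * nevanlinna_char t f + \<bar>jensen_const\<bar> \<le> b * r powr s" if "r \<le> t" "t \<le> 6 * r" for t
    proof -
      have "nevanlinna_char t f \<le> t powr s" using r that by (intro r0) auto
      also have "\<dots> \<le> 6 powr s * r powr s"
        unfolding six[symmetric] using that r1 s by (intro powr_mono2) auto
      moreover have "\<bar>jensen_const\<bar> \<le> \<bar>jensen_const\<bar> * r powr s"
        using mult_left_mono[OF one, of "\<bar>jensen_const\<bar>"] by simp
      ultimately show ?thesis by (simp add: b_def algebra_simps)
    qed
    have "zp_count (3 * r) \<le> (2 * nevanlinna_char (2 * (3 * r)) f + \<bar>jensen_const\<bar>) / ln 2"
      using r1 by (intro zp_count_le) auto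
    also have "\<dots> \<le> b * r powr s / ln 2"
      using T[of "2 * (3 * r)"] r1 by (intro divide_right_mono) auto
    finally have n: "zp_count (3 * r) \<le> c * r powr s" by (simp add: c_def)
    have ln0: "ln (5 * r) \<ge> 0" using r1 by simp
    have "log_deriv_bound r \<le> b * r powr s + c * r powr s * (2 * ln (5 * r))"
      unfolding log_deriv_bound_def using T[of "2 * r"] r1 n ln0
      by (intro add_mono mult_right_mono) auto
    also have "\<dots> \<le> (b + 2 * c) * (r powr s * (1 + ln (5 * r)))"
    proof -
      have "0 \<le> b * r powr s * ln (5 * r) + 2 * c * r powr s"
        using b0 c0 ln0 by (intro add_nonneg_nonneg mult_nonneg_nonneg) auto
      then show ?thesis by (simp add: algebra_simps)
    qed
    finally have "4 / r * log_deriv_bound r \<le> 4 / r * ((b + 2 * c) * (r powr s * (1 + ln (5 * r))))"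
      using r1 by (intro mult_left_mono) auto
    also have "\<dots> = c1 * (r powr (s - 1) * (1 + ln (5 * r)))"
      using r1 by (simp add: c1_def powr_diff)
    finally have D: "4 / r * log_deriv_bound r \<le> c1 * (r powr (s - 1) * (1 + ln (5 * r)))" .
    \<comment> \<open>Needed for the monotonicity of \<open>powr\<close>; the characteristic part is
      nonnegative because it bounds a sum of nonnegative weights.\<close>
    have "log_deriv_bound r \<ge> 0"
    proof -
      have "0 \<le> 2 * nevanlinna_char (2 * r) f + \<bar>jensen_const\<bar>"
        by (rule order_trans[OF _ nevanlinna_char_bounds(1)[of "2 * r" "3 * r"]])
           (use r1 jweight_nonneg in \<open>auto intro!: sum_nonneg mult_nonneg_nonneg\<close>)
      moreover have "0 \<le> zp_count (3 * r) * (2 * ln (5 * r))"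
        using zp_count_nonneg ln0 by simp
      ultimately show ?thesis
        unfolding log_deriv_bound_def by linarith
    qed
    then have D0: "4 / r * log_deriv_bound r \<ge> 0" using r1 by simp
    have "C * zp_count (3 * r) * r powr (-al) \<le> C * (c * r powr s) * r powr (-al)"
      using C(1) n by (intro mult_right_mono mult_left_mono) auto
    also have "\<dots> = (C * c) * r powr (s - al)"
      using r1 by (simp add: powr_diff powr_minus_divide)
    finally have n': "C * zp_count (3 * r) * r powr (-al) \<le> (C * c) * r powr (s - al)" .
    have "log_deriv_proximity r \<le> (1 / al) * ln (1 + ((4 / r * log_deriv_bound r) powr al + C * zp_count (3 * r) * r powr (-al)))"
      unfolding log_deriv_proximity_def
      by (rule log_deriv_proximity_le[OF al C(2,3,1) r1(1) proximity_diff_quotient_tendsto(1)[OF r1(2)]])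
    also have "\<dots> \<le> (1 / al) * ln (1 + ((c1 * (r powr (s - 1) * (1 + ln (5 * r)))) powr al + (C * c) * r powr (s - al)))"
      using al D0 D n' C(1) zp_count_nonneg[of "3 * r"]
      by (intro mult_left_mono ln_mono add_left_mono add_mono powr_mono2)
         (auto intro!: add_pos_nonneg mult_nonneg_nonneg)
    finally show ?thesis .
  qed
  then have "eventually (\<lambda>r. log_deriv_proximity r
      \<le> (1 / al) * ln (1 + ((c1 * (r powr (s - 1) * (1 + ln (5 * r)))) powr al + (C * c) * r powr (s - al)))) at_top"
    unfolding eventually_at_top_linorder by blast
  then show ?thesis
    using that[of c1 "C * c"] b0 c0 C(1) by (simp add: c1_def)
qed

lemma log_deriv_proximity_bounded:
  assumes ord: "nevanlinna_order f < 1"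
  shows "log_deriv_proximity \<in> O[at_top](\<lambda>_. 1)"
proof -
  obtain s0 where s0: "nevanlinna_order f < ereal s0" "ereal s0 < 1"
    using ereal_dense2[OF ord] by blast
  \<comment> \<open>The maximum ensures \<open>0 <= s < 1\<close>. With \<open>al\<close> midway
    between \<open>s\<close> and 1, both exponents \<open>s - 1\<close> and \<open>s - al\<close>
    are negative.\<close>
  define s where "s = max s0 (1/2)"
  define al where "al = (s + 1) / 2"
  have s: "s \<ge> 0" "s < 1" "s < al" "0 < al" "al < 1"
    using s0(2) by (auto simp: s_def al_def one_ereal_def)
  have "nevanlinna_order f < ereal s"
    using s0(1) by (rule order.strict_trans2) (simp add: s_def)
  from growth_bound[OF this s(1,4,5)] obtain c1 c2 where c: "c1 \<ge> 0" "c2 \<ge> 0"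
    "eventually (\<lambda>r. log_deriv_proximity r
      \<le> (1 / al) * ln (1 + ((c1 * (r powr (s - 1) * (1 + ln (5 * r)))) powr al + c2 * r powr (s - al)))) at_top"
    by blast
  have "((\<lambda>r. r powr (s - 1) * (1 + ln (5 * r))) \<longlongrightarrow> 0) at_top"
    using s by real_asymp
  then have "eventually (\<lambda>r. r powr (s - 1) * (1 + ln (5 * r)) < 1) at_top"
    by (rule order_tendstoD) simp
  moreover have "((\<lambda>r. r powr (s - al)) \<longlongrightarrow> 0) at_top"
    using s by real_asymp
  then have "eventually (\<lambda>r. r powr (s - al) < 1) at_top"
    by (rule order_tendstoD) simp
  ultimately have "eventually (\<lambda>r. norm (log_deriv_proximity r) \<le> (1 / al) * ln (1 + (c1 powr al + c2)) * norm (1::real)) at_top"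
    using c(3) eventually_ge_at_top[of 1]
  proof eventually_elim
    case (elim r)
    have "ln (5 * r) \<ge> 0" using elim by simp
    then have "c1 * (r powr (s - 1) * (1 + ln (5 * r))) \<ge> 0" "c1 * (r powr (s - 1) * (1 + ln (5 * r))) \<le> c1"
      using elim c(1) mult_left_mono[of "r powr (s - 1) * (1 + ln (5 * r))" 1 c1] by auto
    then have "(c1 * (r powr (s - 1) * (1 + ln (5 * r)))) powr al \<le> c1 powr al"
      using s by (intro powr_mono2) auto
    moreover have "c2 * r powr (s - al) \<le> c2"
      using elim c(2) mult_left_mono[of "r powr (s - al)" 1 c2] by auto
    ultimately have "log_deriv_proximity r \<le> (1 / al) * ln (1 + (c1 powr al + c2))"
      using elim(3) s c(2)
      by (elim order_trans, intro mult_left_mono ln_mono add_left_mono add_mono) (auto intro!: add_pos_nonneg)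
    moreover have "log_deriv_proximity r \<ge> 0" using elim by (intro log_deriv_proximity_nonneg) simp
    ultimately show ?case by simp
  qed
  then show ?thesis by (rule bigoI)
qed

lemma log_deriv_proximity_bigo_ln:
  assumes ord: "nevanlinna_order f < \<infinity>"
  shows "log_deriv_proximity \<in> O[at_top](\<lambda>r. ln r)"
proof -
  obtain s0 where s0: "nevanlinna_order f < ereal s0"
    using ereal_dense2[OF ord] by blast
  define s where "s = max s0 0"
  have s: "s \<ge> 0" by (simp add: s_def)
  have "nevanlinna_order f < ereal s"
    using s0(1) by (rule order.strict_trans2) (simp add: s_def)
  from growth_bound[OF this s(1), of "1/2"] obtain c1 c2 where c: "c1 \<ge> 0" "c2 \<ge> 0"
    "eventually (\<lambda>r. log_deriv_proximity r
      \<le> 2 * ln (1 + ((c1 * (r powr (s - 1) * (1 + ln (5 * r)))) powr (1/2) + c2 * r powr (s - 1/2)))) at_top"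
    by auto
  \<comment> \<open>The argument of the logarithm will be at most \<open>d * r powr s\<close>; once
    \<open>r >= d\<close> this is at most \<open>r powr (s + 1)\<close>, so no additive constant
    remains next to \<open>ln r\<close>.\<close>
  define d where "d = 2 + 6 * c1 + c2"
  have "eventually (\<lambda>r. norm (log_deriv_proximity r) \<le> (2 * (1 + s)) * norm (ln r)) at_top"
    using c(3) eventually_ge_at_top[of "max d 1"]
  proof eventually_elim
    case (elim r)
    have r: "r \<ge> 1" "r \<ge> d" "r > 0" using elim by auto
    have rs: "1 \<le> r powr s" using r s by (simp add: ge_one_powr_ge_zero)
    have l: "ln (5 * r) \<ge> 0" "ln (5 * r) \<le> 5 * r - 1" using r ln_le_minus_one[of "5 * r"] by auto
    define x where "x = c1 * (r powr (s - 1) * (1 + ln (5 * r)))"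
    have x0: "x \<ge> 0" using c(1) l by (simp add: x_def)
    have "x \<le> c1 * (r powr (s - 1) * (5 * r))"
      unfolding x_def using c(1) l by (intro mult_left_mono) auto
    also have "\<dots> = 5 * c1 * r powr s" using r by (simp add: powr_diff)
    also have "\<dots> \<le> 6 * c1 * r powr s" using c(1) by (intro mult_right_mono) auto
    finally have x: "x \<le> 6 * c1 * r powr s" .
    have "x powr (1/2) \<le> 1 + x"
      using x0 by (cases "x \<ge> 1") (auto intro: order_trans[OF powr_mono[of "1/2" 1 x]] order_trans[OF powr_mono2[of "1/2" x 1]])
    moreover have "c2 * r powr (s - 1/2) \<le> c2 * r powr s"
      using c(2) r by (intro mult_left_mono powr_mono) auto
    ultimately have "1 + (x powr (1/2) + c2 * r powr (s - 1/2)) \<le> 2 + 6 * c1 * r powr s + c2 * r powr s"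
      using x by simp
    also have "\<dots> \<le> d * r powr s" using rs by (simp add: d_def algebra_simps)
    also have "\<dots> \<le> r * r powr s" using r by (intro mult_right_mono) auto
    finally have "ln (1 + (x powr (1/2) + c2 * r powr (s - 1/2))) \<le> ln (r * r powr s)"
      using c(2) by (intro ln_mono) (auto intro!: add_pos_nonneg)
    also have "\<dots> = (1 + s) * ln r" using r by (simp add: ln_mult ln_powr algebra_simps)
    finally have "log_deriv_proximity r \<le> 2 * ((1 + s) * ln r)"
      using elim(1) unfolding x_def by simp
    moreover have "log_deriv_proximity r \<ge> 0" using r by (intro log_deriv_proximity_nonneg) simp
    ultimately show ?case using r by (simp add: algebra_simps)
  qed
  then show ?thesis by (rule bigoI)
qed

end

theorem corollary14p2:
  fixes f :: "complex \<Rightarrow> complex" and \<sigma> :: real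
  assumes "f meromorphic_on UNIV"
    and "\<not> (\<forall>\<^sub>\<approx>z. f z = 0)"
    and "nevanlinna_order f = ereal \<sigma>"
  shows "\<exists>L :: real \<Rightarrow> real.
           (\<forall>r>0. ((\<lambda>\<eta>::complex. proximity r (\<lambda>z. 1 / \<eta> * (f (z + \<eta>) / f z - 1)))
                    \<longlongrightarrow> L r) (at 0)) \<and>
           (\<sigma> \<ge> 1 \<longrightarrow> L \<in> O[at_top](\<lambda>r. ln r)) \<and>
           (\<sigma> < 1 \<longrightarrow> L \<in> O[at_top](\<lambda>_. 1))"
proof -
  interpret nonzero_meromorphic f
    using assms(1,2) by unfold_locales
  have "\<forall>r>0. ((\<lambda>\<eta>::complex. proximity r (\<lambda>z. 1 / \<eta> * (f (z + \<eta>) / f z - 1)))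
                    \<longlongrightarrow> log_deriv_proximity r) (at 0)"
    unfolding log_deriv_proximity_def using proximity_diff_quotient_tendsto(2) by blast
  moreover have "log_deriv_proximity \<in> O[at_top](\<lambda>r. ln r)"
    by (rule log_deriv_proximity_bigo_ln) (simp add: assms(3))
  moreover have "\<sigma> < 1 \<longrightarrow> log_deriv_proximity \<in> O[at_top](\<lambda>_. 1)"
    using log_deriv_proximity_bounded by (simp add: assms(3) one_ereal_def)
  ultimately show ?thesis by blast
qed

end
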